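(* Let $K$ be an algebraically closed field complete with respect to a non-trivial non-archimedean absolute value $|\cdot|$, and let $\phi\in K(z)$ be a rational function of degree $d\geq 2$, where $\operatorname{char}K=0$ or $\operatorname{char}K>d$. Suppose that $\phi$ has a fixed point $\gamma$ with multiplier $\lambda$ satisfying $$0<|\lambda|<|\deg_{\zeta,\vec v}\phi|^d$$ for all points $\zeta=\zeta(a,r)$ ($a\in K$, $r>0$) and all directions $\vec v$ at $\zeta$. Then there is a disk $U\subseteq\mathbb{P}^1(K)$ containing $\gamma$ such that $\phi$ maps $U$ into itself injectively, all points of $U$ are attracted to $\gamma$ under iteration, and $U$ contains a critical value of $\phi$ that is strictly attracted to $\gamma$.
   Context: Here $|\deg_{\zeta,\vec v}\phi|$ is the absolute value in $K$ of the positive integer $\deg_{\zeta,\vec v}\phi$, defined as follows. For $a\in K$ and $r>0$, the point $\zeta(a,r)$ corresponds to the closed disk $\overline{D}(a,r)=\{x\in K:|x-a|\leq r\}$. Its directions are: the direction of $\infty$, and for each $b\in\overline{D}(a,r)$ the direction of $b$ (two points $b,b'$ give the same direction iff $|b-b'|<r$). For the direction of $\infty$ let $X_\varepsilon=\{x:r<|x-a|<r+\varepsilon\}$, and for the direction of $b$ let $X_\varepsilon=\{x:r-\varepsilon<|x-b|<r\}$. For all sufficiently small $\varepsilon>0$, $\phi$ maps $X_\varepsilon$ onto an open annulus in $\mathbb{P}^1(K)$ and is everywhere $m$-to-$1$ (with multiplicity) onto it, with $m$ independent of small $\varepsilon$; this $m$ is $\deg_{\zeta,\vec v}\phi$. A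 disk in $\mathbb{P}^1(K)$ is a disk in $K$ or the complement of one. The multiplier of $\gamma$ is $\phi'(\gamma)$ computed in a coordinate where $\gamma\neq\infty$; $x$ is attracted to $\gamma$ if $\phi^n(x)\to\gamma$, and strictly attracted if moreover $\phi^l(x)\neq\gamma$ for all $l\geq1$. *)

theory Defs
  imports
    "HOL-Analysis.Abstract_Metric_Spaces"
    "HOL-Computational_Algebra.Computational_Algebra"
begin

locale complete_nonarch_abs =
  fixes v :: "'k::field \<Rightarrow> real"
  assumes nonneg: "v x \<ge> 0"
    and eq_0_iff: "v x = 0 \<longleftrightarrow> x = 0"
    and mult: "v (x * y) = v x * v y"
    and ultrametric: "v (x + y) \<le> max (v x) (v y)"
    and nontrivial: "\<exists>x. x \<noteq> 0 \<and> v x \<noteq> 1"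
    and complete: "Metric_space.mcomplete UNIV (\<lambda>x y. v (x - y))"

lemma (in complete_nonarch_abs) Metric_space_abs: "Metric_space UNIV (\<lambda>x y. v (x - y))"
proof -
  have "v 1 * v 1 = v 1" "v 1 \<noteq> 0"
    by (simp_all add: mult [symmetric] eq_0_iff)
  then have "v 1 = 1" by simp
  have "v (-1) * v (-1) = 1"
    by (simp add: mult [symmetric] \<open>v 1 = 1\<close>)
  then have "v (-1) = 1"
    using nonneg [of "-1"] by (simp add: square_eq_1_iff)
  then have minus: "v (- x) = v x" for x
    using mult [of "-1" x] by simp
  show ?thesis
  proof
    fix x y z
    show "0 \<le> v (x - y)" by (rule nonneg)
    show "v (x - y) = v (y - x)" using minus [of "x - y"] by simp
    show "v (x - y) = 0 \<longleftrightarrow> x = y" by (simp add: eq_0_iff)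
    have "v (x - z) \<le> max (v (x - y)) (v (y - z))"
      using ultrametric [of "x - y" "y - z"] by simp
    then show "v (x - z) \<le> v (x - y) + v (y - z)"
      using nonneg [of "x - y"] nonneg [of "y - z"] by linarith
  qed
qed


datatype 'k proj_line = Fin 'k | Infty

text \<open>The chordal (spherical) metric, which induces the usual topology of the projective line.\<close>

fun chordal :: "('k::field \<Rightarrow> real) \<Rightarrow> 'k proj_line \<Rightarrow> 'k proj_line \<Rightarrow> real" where
  "chordal v (Fin x) (Fin y) = v (x - y) / (max 1 (v x) * max 1 (v y))"
| "chordal v (Fin x) Infty = 1 / max 1 (v x)"
| "chordal v Infty (Fin y) = 1 / max 1 (v y)"
| "chordal v Infty Infty = 0"

definition open_disk :: "('k::field \<Rightarrow> real) \<Rightarrow> 'k \<Rightarrow> real \<Rightarrow> 'k proj_line set" where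
  "open_disk v a r = Fin ` {x. v (x - a) < r}"

definition closed_disk :: "('k::field \<Rightarrow> real) \<Rightarrow> 'k \<Rightarrow> real \<Rightarrow> 'k proj_line set" where
  "closed_disk v a r = Fin ` {x. v (x - a) \<le> r}"

definition is_disk :: "('k::field \<Rightarrow> real) \<Rightarrow> 'k proj_line set \<Rightarrow> bool" where
  "is_disk v U \<longleftrightarrow> (\<exists>a r. r > 0 \<and>
     (U = open_disk v a r \<or> U = closed_disk v a r \<or>
      U = - open_disk v a r \<or> U = - closed_disk v a r))"

definition is_closed_disk :: "('k::field \<Rightarrow> real) \<Rightarrow> 'k proj_line set \<Rightarrow> bool" where
  "is_closed_disk v D \<longleftrightarrow> (\<exists>a r. r > 0 \<and> (D = closed_disk v a r \<or> D = - open_disk v a r))"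

text \<open>An open annulus in the projective line is the complement of two disjoint closed disks, for
  instance \<open>{x. r < v (x - a) < s}\<close> with \<open>0 < r < s\<close>. Nonemptiness must be required because, if
  \<open>r\<close> is not a value of \<open>v\<close>, the disjoint closed disks \<open>closed_disk v a r\<close> and
  \<open>- open_disk v a r\<close> cover everything.\<close>

definition is_open_annulus :: "('k::field \<Rightarrow> real) \<Rightarrow> 'k proj_line set \<Rightarrow> bool" where
  "is_open_annulus v A \<longleftrightarrow> A \<noteq> {} \<and>
     (\<exists>D E. is_closed_disk v D \<and> is_closed_disk v E \<and> D \<inter> E = {} \<and> A = - (D \<union> E))"


text \<open>A rational function is given in lowest terms, as \<open>p / q\<close> with \<open>coprime p q\<close> and \<open>q \<noteq> 0\<close>.\<close>

definition rat_degree :: "'k::field poly \<Rightarrow> 'k poly \<Rightarrow> nat" where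
  "rat_degree p q = max (degree p) (degree q)"

fun rat_map :: "'k::field poly \<Rightarrow> 'k poly \<Rightarrow> 'k proj_line \<Rightarrow> 'k proj_line" where
  "rat_map p q (Fin x) = (if poly q x = 0 then Infty else Fin (poly p x / poly q x))"
| "rat_map p q Infty =
     (let d = rat_degree p q in
      if coeff q d = 0 then Infty else Fin (coeff p d / coeff q d))"

text \<open>\<open>fibre_poly p q y\<close> has the finite points of the fibre over \<open>y\<close> as its roots, with the right
  multiplicities; the multiplicity of \<open>\<infinity>\<close> is what is missing to reach the degree \<open>rat_degree p q\<close>.\<close>

fun fibre_poly :: "'k::field poly \<Rightarrow> 'k poly \<Rightarrow> 'k proj_line \<Rightarrow> 'k poly" where
  "fibre_poly p q (Fin c) = p - smult c q"
| "fibre_poly p q Infty = q"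

fun local_mult :: "'k::field poly \<Rightarrow> 'k poly \<Rightarrow> 'k proj_line \<Rightarrow> nat" where
  "local_mult p q (Fin x) = order x (fibre_poly p q (rat_map p q (Fin x)))"
| "local_mult p q Infty = rat_degree p q - degree (fibre_poly p q (rat_map p q Infty))"

definition critical_point :: "'k::field poly \<Rightarrow> 'k poly \<Rightarrow> 'k proj_line \<Rightarrow> bool" where
  "critical_point p q x \<longleftrightarrow> local_mult p q x \<ge> 2"

definition critical_value :: "'k::field poly \<Rightarrow> 'k poly \<Rightarrow> 'k proj_line \<Rightarrow> bool" where
  "critical_value p q y \<longleftrightarrow> (\<exists>x. critical_point p q x \<and> y = rat_map p q x)"

text \<open>\<open>rev_poly n p\<close> is \<open>w ^ n * p (1 / w)\<close> for \<open>n \<ge> degree p\<close>. In the coordinate \<open>w = 1 / z\<close> the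
  function \<open>p / q\<close> of degree \<open>d\<close> becomes \<open>rev_poly d q / rev_poly d p\<close>.\<close>

definition rev_poly :: "nat \<Rightarrow> 'k::field poly \<Rightarrow> 'k poly" where
  "rev_poly n p = monom 1 (n - degree p) * reflect_poly p"

definition rat_deriv :: "'k::field poly \<Rightarrow> 'k poly \<Rightarrow> 'k \<Rightarrow> 'k" where
  "rat_deriv p q x = poly (pderiv p * q - p * pderiv q) x / (poly q x)\<^sup>2"

fun multiplier :: "'k::field poly \<Rightarrow> 'k poly \<Rightarrow> 'k proj_line \<Rightarrow> 'k" where
  "multiplier p q (Fin c) = rat_deriv p q c"
| "multiplier p q Infty =
     (let d = rat_degree p q in rat_deriv (rev_poly d q) (rev_poly d p) 0)"

definition attracted ::
    "('k::field \<Rightarrow> real) \<Rightarrow> 'k poly \<Rightarrow> 'k poly \<Rightarrow> 'k proj_line \<Rightarrow> 'k proj_line \<Rightarrow> bool" where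
  "attracted v p q \<gamma> x \<longleftrightarrow> (\<lambda>n. chordal v ((rat_map p q ^^ n) x) \<gamma>) \<longlonglongrightarrow> 0"

definition strictly_attracted ::
    "('k::field \<Rightarrow> real) \<Rightarrow> 'k poly \<Rightarrow> 'k poly \<Rightarrow> 'k proj_line \<Rightarrow> 'k proj_line \<Rightarrow> bool" where
  "strictly_attracted v p q \<gamma> x \<longleftrightarrow>
     attracted v p q \<gamma> x \<and> (\<forall>l\<ge>1. (rat_map p q ^^ l) x \<noteq> \<gamma>)"


text \<open>A point \<open>\<zeta>(a,r)\<close> is given by \<open>a\<close> and \<open>r > 0\<close>, and a direction at it by a representative: \<open>Infty\<close>
  or \<open>Fin b\<close> with \<open>b\<close> in the closed disk. Representatives are not unique, but equivalent ones
  define the same sets \<open>dir_annulus\<close> for small \<open>\<epsilon>\<close>.\<close>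

definition is_direction :: "('k::field \<Rightarrow> real) \<Rightarrow> 'k \<Rightarrow> real \<Rightarrow> 'k proj_line \<Rightarrow> bool" where
  "is_direction v a r w \<longleftrightarrow> w = Infty \<or> w \<in> closed_disk v a r"

fun dir_annulus ::
    "('k::field \<Rightarrow> real) \<Rightarrow> 'k \<Rightarrow> real \<Rightarrow> 'k proj_line \<Rightarrow> real \<Rightarrow> 'k proj_line set" where
  "dir_annulus v a r Infty \<epsilon> = Fin ` {x. r < v (x - a) \<and> v (x - a) < r + \<epsilon>}"
| "dir_annulus v a r (Fin b) \<epsilon> = Fin ` {x. r - \<epsilon> < v (x - b) \<and> v (x - b) < r}"

definition maps_onto_annulus_m_to_1 ::
    "('k::field \<Rightarrow> real) \<Rightarrow> 'k poly \<Rightarrow> 'k poly \<Rightarrow> 'k proj_line set \<Rightarrow> nat \<Rightarrow> bool" where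
  "maps_onto_annulus_m_to_1 v p q X m \<longleftrightarrow>
     is_open_annulus v (rat_map p q ` X) \<and>
     (\<forall>y \<in> rat_map p q ` X. (\<Sum>x | x \<in> X \<and> rat_map p q x = y. local_mult p q x) = m)"

definition dir_degree ::
    "('k::field \<Rightarrow> real) \<Rightarrow> 'k poly \<Rightarrow> 'k poly \<Rightarrow> 'k \<Rightarrow> real \<Rightarrow> 'k proj_line \<Rightarrow> nat" where
  "dir_degree v p q a r w =
     (THE m. \<exists>\<epsilon>\<^sub>0>0. \<forall>\<epsilon>. 0 < \<epsilon> \<and> \<epsilon> < \<epsilon>\<^sub>0 \<longrightarrow>
        maps_onto_annulus_m_to_1 v p q (dir_annulus v a r w \<epsilon>) m)"

end

theory Submission
  imports Defs
begin

text \<open>Move \<open>\<gamma>\<close> to \<open>\<infinity>\<close>, where \<open>\<phi> = P / Q\<close> with \<open>degree P = degree Q + 1\<close>, and choose a pole \<open>a\<close> of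
  \<open>\<phi>\<close>. Let \<open>r\<close> be the largest distance from \<open>a\<close> of a root of \<open>p = P - a Q\<close> or of \<open>Q\<close>. Outside the
  disk of radius \<open>r\<close> around \<open>a\<close> we have \<open>|\<phi> x - a| = |x - a| / |\<lambda>|\<close>, and \<open>\<phi>\<close> is injective there; this
  is \<open>U\<close>. Suppose that \<open>U\<close> contains no critical value other than \<open>\<gamma>\<close>. Descend from \<open>\<zeta>(a,r)\<close> through
  smaller disks and follow the Gauss norms \<open>F\<close> of \<open>\<phi> - a = p / Q\<close> and \<open>G\<close> of
  \<open>t \<phi>' / (\<phi> - a) = - t W / (p Q)\<close> at \<open>\<zeta>(b,t)\<close>, where \<open>W = p Q' - p' Q\<close>. As long as \<open>F > r\<close>, every zero
  of \<open>W\<close> is a pole of \<open>\<phi>\<close>, so counting roots shows that at each branching some smaller disk contains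
  at least as many roots of \<open>W\<close> as of \<open>p Q\<close>; in that direction \<open>G\<close> decreases at least like \<open>t\<close>. Hence
  \<open>G \<le> t / r\<close> all along, while \<open>F \<ge> (r / |\<lambda>|) (t / r) ^ d\<close>. The order of \<open>W\<close> at a pole of \<open>\<phi>\<close> is less
  than the order of the pole, so the descent cannot end there. Hence \<open>F = r\<close> for some \<open>t\<close>, and then
  \<open>(t / r) ^ d \<le> |\<lambda>|\<close>. If \<open>m\<close> is the degree of \<open>\<phi>\<close> in the upward direction, then \<open>m\<close> is the constant
  term of the Laurent expansion of \<open>x \<phi>' / (\<phi> - a)\<close>, so \<open>|m| \<le> G \<le> t / r\<close>. This contradicts
  \<open>|\<lambda>| < |m| ^ d\<close>.\<close>

section \<open>Roots and Gauss norms\<close>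

text \<open>Algebraic closedness yields some multiset of linear factors; computing the roots of
  their product identifies it with \<open>proots g\<close>.\<close>

lemma poly_eq_prod_proots:
  fixes g :: "'k::alg_closed_field poly"
  shows "g = smult (lead_coeff g) (\<Prod>x\<in>#proots g. [:- x, 1:])"
proof (cases "g = 0")
  case False
  then obtain A where A: "g = smult (lead_coeff g) (\<Prod>x\<in>#A. [:-x, 1:])"
    using alg_closed_imp_factorization[of g] by blast
  have "proots (\<Prod>x\<in>#B. [:-x, 1:]) = B" for B :: "'k multiset"
  proof (induction B)
    case (add x B)
    have "(\<Prod>x\<in>#B. [:-x, 1:]) \<noteq> 0" by (auto simp: prod_mset_zero_iff)
    then have "proots ([:-x,1:] * (\<Prod>x\<in>#B. [:-x, 1:])) = {#x#} + B"
      by (subst proots_mult) (use add in auto)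
    then show ?case by simp
  qed simp
  then have "proots g = A"
    by (subst A, subst proots_smult) (use False in auto)
  with A show ?thesis by simp
qed simp

lemma size_proots [simp]: "size (proots (g :: 'k::alg_closed_field poly)) = degree g"
proof (cases "g = 0")
  case False
  have "degree (\<Prod>x\<in>#B. [:-x, 1:]) = size B" for B :: "'k multiset"
  proof (induction B)
    case (add x B)
    have "(\<Prod>x\<in>#B. [:-x, 1:]) \<noteq> 0" by (auto simp: prod_mset_zero_iff)
    then have "degree ([:-x,1:] * (\<Prod>x\<in>#B. [:-x, 1:])) = 1 + size B"
      by (subst degree_mult_eq) (use add in auto)
    then show ?case by simp
  qed simp
  from this[of "proots g"] show ?thesis
    using arg_cong[OF poly_eq_prod_proots[of g], of degree] False by simp
qed simp

lemma poly_eq_prod_mset: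
  fixes g :: "'k::alg_closed_field poly"
  shows "poly g x = lead_coeff g * (\<Prod>\<rho>\<in>#proots g. x - \<rho>)"
proof -
  have "poly (\<Prod>x\<in>#B. [:-x, 1:]) x = (\<Prod>\<rho>\<in>#B. x - \<rho>)" for B :: "'k multiset"
    by (induction B) (auto simp: algebra_simps)
  then show ?thesis
    using arg_cong[OF poly_eq_prod_proots[of g], of "\<lambda>g. poly g x"] by simp
qed

definition num_roots :: "'k::idom poly \<Rightarrow> 'k set \<Rightarrow> nat" where
  "num_roots g S = size {#x \<in># proots g. x \<in> S#}"

lemma num_roots_sum:
  assumes "g \<noteq> 0"
  shows "num_roots g S = (\<Sum>x | poly g x = 0 \<and> x \<in> S. order x g)"
proof -
  have "num_roots g S = (\<Sum>x\<in>set_mset {#x \<in># proots g. x \<in> S#}. count {#x \<in># proots g. x \<in> S#} x)"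
    unfolding num_roots_def by (rule size_multiset_overloaded_eq)
  also have "\<dots> = (\<Sum>x | poly g x = 0 \<and> x \<in> S. order x g)"
    by (rule sum.cong) (use assms in auto)
  finally show ?thesis .
qed

lemma num_roots_cong:
  assumes "g \<noteq> 0" "\<And>x. poly g x = 0 \<Longrightarrow> x \<in> S \<longleftrightarrow> x \<in> T"
  shows "num_roots g S = num_roots g T"
  unfolding num_roots_def by (rule arg_cong[where f = size], rule filter_mset_cong) (use assms in auto)

lemma num_roots_UN:
  assumes "g \<noteq> 0" "finite \<D>" "disjoint \<D>"
  shows "num_roots g (\<Union>\<D>) = (\<Sum>D\<in>\<D>. num_roots g D)"
proof -
  have fin: "finite {x. poly g x = 0}" using assms(1) by (rule poly_roots_finite)
  have "{x. poly g x = 0 \<and> x \<in> \<Union>\<D>} = (\<Union>D\<in>\<D>. {x. poly g x = 0 \<and> x \<in> D})" by auto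
  then have "num_roots g (\<Union>\<D>) = (\<Sum>x\<in>(\<Union>D\<in>\<D>. {x. poly g x = 0 \<and> x \<in> D}). order x g)"
    using num_roots_sum[OF assms(1)] by metis
  also have "\<dots> = (\<Sum>D\<in>\<D>. \<Sum>x | poly g x = 0 \<and> x \<in> D. order x g)"
  proof (rule sum.UNION_disjoint[OF assms(2)])
    show "\<forall>D\<in>\<D>. finite {x. poly g x = 0 \<and> x \<in> D}"
      using fin by (auto intro: finite_subset)
    show "\<forall>i\<in>\<D>. \<forall>j\<in>\<D>. i \<noteq> j \<longrightarrow>
      {x. poly g x = 0 \<and> x \<in> i} \<inter> {x. poly g x = 0 \<and> x \<in> j} = {}"
      using assms(3) by (auto simp: disjoint_def)
  qed
  finally show ?thesis by (simp add: num_roots_sum[OF assms(1)])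
qed

lemma num_roots_less:
  assumes "g \<noteq> 0" "S \<subseteq> T" "poly g x = 0" "x \<in> T" "x \<notin> S"
  shows "num_roots g S < num_roots g T"
proof -
  have "{#x \<in># proots g. x \<in> S#} \<subset># {#x \<in># proots g. x \<in> T#}"
  proof (rule subset_mset.neq_le_trans)
    show "{#x \<in># proots g. x \<in> S#} \<noteq> {#x \<in># proots g. x \<in> T#}"
      using assms by (metis (mono_tags, lifting) mem_Collect_eq set_count_proots set_mset_filter)
    show "{#x \<in># proots g. x \<in> S#} \<subseteq># {#x \<in># proots g. x \<in> T#}"
      using assms by (intro filter_mset_mono_strong) auto
  qed
  then show ?thesis unfolding num_roots_def by (rule mset_subset_size)
qed

lemma num_roots_le_degree: "num_roots g S \<le> degree (g :: 'k::alg_closed_field poly)"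
  unfolding num_roots_def by (metis size_filter_mset_lesseq size_proots)

lemma num_roots_all:
  assumes "\<And>x. poly g x = 0 \<Longrightarrow> x \<in> S" "g \<noteq> 0"
  shows "num_roots g S = degree (g :: 'k::alg_closed_field poly)"
  using num_roots_cong[of g S UNIV] assms by (simp add: num_roots_def)

section \<open>Arithmetic of the absolute value and density of its values\<close>

locale alg_closed_nonarch_abs = complete_nonarch_abs v for v :: "'k::alg_closed_field \<Rightarrow> real"
begin

lemma abs_0 [simp]: "v 0 = 0" by (simp add: eq_0_iff)

lemma abs_1 [simp]: "v 1 = 1"
proof -
  have "v 1 * v 1 = v 1" "v 1 \<noteq> 0" by (simp_all add: mult [symmetric] eq_0_iff)
  then show ?thesis by simp
qed

lemma abs_pos [simp]: "0 < v x \<longleftrightarrow> x \<noteq> 0"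
  using nonneg[of x] eq_0_iff[of x] by linarith

lemma abs_minus [simp]: "v (- x) = v x"
proof -
  have "v (-1) * v (-1) = 1" by (simp add: mult [symmetric])
  then have "v (-1) = 1" using nonneg [of "-1"] by (simp add: square_eq_1_iff)
  then show ?thesis using mult [of "-1" x] by simp
qed

lemma abs_minus_commute: "v (x - y) = v (y - x)"
  using abs_minus[of "x - y"] by simp

lemma abs_power: "v (x ^ n) = v x ^ n"
  by (induction n) (simp_all add: mult)

lemma abs_divide: "v (x / y) = v x / v y"
proof (cases "y = 0")
  case False
  then show ?thesis using mult[of "x / y" y] by (simp add: field_simps eq_0_iff)
qed simp

lemma abs_inverse: "v (inverse x) = inverse (v x)"
  using abs_divide[of 1 x] by (simp add: field_simps)

lemma abs_prod_mset: "v (\<Prod>x\<in>#A. f x) = (\<Prod>x\<in>#A. v (f x))"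
  by (induction A) (auto simp: mult)

lemma abs_diff_le: "v (x - y) \<le> max (v x) (v y)"
  using ultrametric[of x "- y"] by simp

lemma abs_add_eq: "v x < v y \<Longrightarrow> v (x + y) = v y"
  using ultrametric[of x y] ultrametric[of "x + y" "- x"] by auto

lemma abs_add_eq': "v y < v x \<Longrightarrow> v (x + y) = v x"
  using abs_add_eq[of y x] by (simp add: add.commute)

lemma abs_triangle: "v (x - z) \<le> max (v (x - y)) (v (y - z))"
  using ultrametric[of "x - y" "y - z"] by simp

lemma abs_sum_mset_le: "B \<ge> 0 \<Longrightarrow> (\<And>x. x \<in># A \<Longrightarrow> v (f x) \<le> B) \<Longrightarrow> v (\<Sum>x\<in>#A. f x) \<le> B"
proof (induction A)
  case (add x A)
  then show ?case using ultrametric[of "f x" "\<Sum>x\<in>#A. f x"] by fastforce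
qed simp

lemma abs_of_nat_le_1: "v (of_nat n) \<le> 1"
proof (induction n)
  case (Suc n)
  then show ?case using ultrametric[of 1 "of_nat n"] by simp
qed simp

text \<open>An \<open>n\<close>-th root \<open>y\<close> of an element of absolute value above 1 has
  \<open>v y\<close> as close to 1 as desired. For large \<open>n\<close> the absolute values of its
  integer powers are too dense to skip a given interval.\<close>

lemma abs_dense:
  assumes "0 \<le> s" "s < t"
  obtains x where "s < v x" "v x < t"
proof -
  obtain z0 where z0: "z0 \<noteq> 0" "v z0 \<noteq> 1" using nontrivial by auto
  define z where "z = (if v z0 > 1 then z0 else inverse z0)"
  have z: "v z > 1" "z \<noteq> 0"
    using z0 nonneg[of z0] by (auto simp: z_def abs_inverse one_less_inverse_iff)
  \<comment> \<open>The lower end is replaced by \<open>max s (t/2)\<close>, which is positive even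
    if \<open>s = 0\<close>.\<close>
  obtain n :: nat where n: "n > 0" "v z powr (1 / real n) < t / max s (t/2)"
  proof -
    have "(\<lambda>n. v z powr (1 / real n)) \<longlonglongrightarrow> v z powr 0"
      by (intro tendsto_powr tendsto_const lim_1_over_n) (use z in auto)
    moreover have "v z powr 0 < t / max s (t/2)"
      using z assms by (auto simp: max_def field_simps)
    ultimately have "eventually (\<lambda>n. v z powr (1 / real n) < t / max s (t/2)) sequentially"
      by (rule order_tendstoD(2))
    then have "eventually (\<lambda>n. v z powr (1 / real n) < t / max s (t/2) \<and> n > 0) sequentially"
      using eventually_gt_at_top by (rule eventually_conj)
    then show ?thesis using that by (auto simp: eventually_sequentially)
  qed
  obtain y where y: "y ^ n = z" using nth_root_exists[of n z] n by auto
  have y1: "v y > 1"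
  proof (rule ccontr)
    assume "\<not> v y > 1"
    then have "v y ^ n \<le> 1" using nonneg[of y] by (auto intro: power_le_one)
    then show False using y z by (simp add: abs_power [symmetric])
  qed
  have "v y = v z powr (1 / real n)"
  proof -
    have "v z = v y powr real n"
      unfolding y[symmetric] abs_power by (rule powr_realpow[symmetric]) (use y1 in linarith)
    then show ?thesis using n y1 by (simp add: powr_powr)
  qed
  then have yt: "v y * max s (t/2) < t" using n assms by (simp add: field_simps max_def split: if_splits)
  define m where "m = max s (t/2)"
  have m: "m > 0" "s \<le> m" "m < t" using assms by (auto simp: m_def max_def)
  \<comment> \<open>The \<open>k\<close>-th power of \<open>v y\<close> is the first integer power
    above \<open>m\<close>; it is at most \<open>v y * m < t\<close>.\<close>
  define k where "k = \<lfloor>log (v y) m\<rfloor> + 1"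
  have k: "real_of_int k > log (v y) m" "real_of_int k \<le> log (v y) m + 1"
    unfolding k_def by linarith+
  define x where "x = (if k \<ge> 0 then y ^ nat k else inverse (y ^ nat (- k)))"
  have vx: "v x = v y powr real_of_int k"
  proof -
    have "0 < v y" using y1 by linarith
    then show ?thesis by (simp only: powr_real_of_int) (simp add: x_def abs_power abs_inverse)
  qed
  have lg: "v y powr log (v y) m = m"
    by (rule powr_log_cancel) (use y1 m in linarith)+
  have "v y powr log (v y) m < v y powr real_of_int k"
    using k y1 by (intro powr_less_mono) auto
  then have "m < v x" using vx lg by simp
  moreover have "v y powr real_of_int k \<le> v y powr (log (v y) m + 1)"
    using k y1 by (intro powr_mono) auto
  then have "v x \<le> v y * m" using vx lg y1 by (simp add: powr_add mult.commute)
  ultimately show ?thesis using that[of x] yt m by (simp add: m_def)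
qed

section \<open>Disks and Gauss norms\<close>

definition odisk :: "'k \<Rightarrow> real \<Rightarrow> 'k set" where "odisk b t = {x. v (x - b) < t}"
definition cdisk :: "'k \<Rightarrow> real \<Rightarrow> 'k set" where "cdisk b t = {x. v (x - b) \<le> t}"

text \<open>The seminorm of the point \<open>\<zeta>(b,t)\<close>, that is, the maximum of
  \<open>v c * t ^ j\<close> over the Taylor coefficients \<open>c\<close> of degree
  \<open>j\<close> at \<open>b\<close>. The product over the roots has the same value and makes the
  dependence on \<open>t\<close> visible.\<close>

definition gauss_norm :: "'k poly \<Rightarrow> 'k \<Rightarrow> real \<Rightarrow> real" where
  "gauss_norm g b t = v (lead_coeff g) * (\<Prod>\<rho>\<in>#proots g. max t (v (\<rho> - b)))"

lemma odisk_recentre: "x \<in> odisk b t \<Longrightarrow> odisk x t = odisk b t"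
  unfolding odisk_def using abs_triangle abs_minus_commute
  by (smt (verit, best) Collect_cong mem_Collect_eq)

lemma gauss_norm_pos: "g \<noteq> 0 \<Longrightarrow> t > 0 \<Longrightarrow> gauss_norm g b t > 0"
proof -
  have "t > 0 \<Longrightarrow> (\<Prod>\<rho>\<in>#A. max t (v (\<rho> - b))) > 0" for A by (induction A) auto
  then show "g \<noteq> 0 \<Longrightarrow> t > 0 \<Longrightarrow> gauss_norm g b t > 0" by (simp add: gauss_norm_def)
qed

lemma max_recentre: "v (x - b) \<le> t \<Longrightarrow> max t (v (\<rho> - x)) = max t (v (\<rho> - b))"
  using abs_triangle[of \<rho> b x] abs_triangle[of \<rho> x b] abs_minus_commute[of x b] by auto

lemma gauss_norm_recentre:
  assumes "v (x - b) \<le> t"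
  shows "gauss_norm g x t = gauss_norm g b t"
  unfolding gauss_norm_def by (simp add: max_recentre[OF assms])

lemma abs_poly_le_gauss_norm: "v (poly g x) \<le> gauss_norm g b (v (x - b))"
proof -
  have "(\<Prod>\<rho>\<in>#A. v (x - \<rho>)) \<le> (\<Prod>\<rho>\<in>#A. max (v (x - b)) (v (\<rho> - b)))
     \<and> 0 \<le> (\<Prod>\<rho>\<in>#A. v (x - \<rho>))" for A
  proof (induction A)
    case (add \<rho> A)
    have "v (x - \<rho>) \<le> max (v (x - b)) (v (\<rho> - b))"
      using abs_triangle[of x \<rho> b] abs_minus_commute[of b \<rho>] by simp
    then show ?case using add nonneg[of "x - \<rho>"] by (auto intro!: mult_mono simp: le_max_iff_disj nonneg)
  qed simp
  then show ?thesis unfolding gauss_norm_def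
    by (subst poly_eq_prod_mset) (auto simp: mult abs_prod_mset nonneg intro!: mult_left_mono)
qed

text \<open>Without roots in the open disk of radius \<open>t\<close> around \<open>x\<close>, every
  root has distance at least \<open>t\<close> from \<open>x\<close>, so each linear factor attains
  its bound.\<close>

lemma abs_poly_eq_gauss_norm:
  assumes "v (x - b) \<le> t" "\<And>y. y \<in> odisk x t \<Longrightarrow> poly g y \<noteq> 0" "g \<noteq> 0"
  shows "v (poly g x) = gauss_norm g b t"
proof -
  have "v (x - \<rho>) = max t (v (\<rho> - b))" if "\<rho> \<in># proots g" for \<rho>
  proof -
    have "\<rho> \<notin> odisk x t" using assms that by auto
    then have "v (x - \<rho>) \<ge> t" by (auto simp: odisk_def abs_minus_commute)
    then show ?thesis using max_recentre[OF assms(1), of \<rho>] abs_minus_commute[of x \<rho>] by simp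
  qed
  then show ?thesis unfolding gauss_norm_def
    by (subst poly_eq_prod_mset) (auto simp: mult abs_prod_mset intro!: arg_cong[of _ _ prod_mset] image_mset_cong)
qed

text \<open>The factors of the roots in \<open>odisk b s\<close> shrink by \<open>t / s\<close> and
  the others do not change. In logarithmic scale the number of roots is the slope.\<close>

lemma gauss_norm_scale:
  assumes "0 < t" "t \<le> s" "g \<noteq> 0" "\<And>x. poly g x = 0 \<Longrightarrow> v (x - b) \<le> t \<or> v (x - b) \<ge> s"
  shows "gauss_norm g b t = gauss_norm g b s * (t / s) ^ num_roots g (odisk b s)"
proof -
  have "(\<Prod>\<rho>\<in>#A. max t (v (\<rho> - b))) =
    (\<Prod>\<rho>\<in>#A. max s (v (\<rho> - b))) * (t / s) ^ size {#x \<in># A. x \<in> odisk b s#}"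
    if "\<And>x. x \<in># A \<Longrightarrow> v (x - b) \<le> t \<or> v (x - b) \<ge> s" for A
    using that
  proof (induction A)
    case (add \<rho> A)
    have "v (\<rho> - b) \<le> t \<or> v (\<rho> - b) \<ge> s" using add.prems by auto
    then have "max t (v (\<rho> - b)) = max s (v (\<rho> - b)) * (if \<rho> \<in> odisk b s then t / s else 1)"
      using assms(1,2) by (auto simp: odisk_def)
    then show ?case using add by (cases "\<rho> \<in> odisk b s") (simp_all add: mult_ac)
  qed simp
  from this[of "proots g"] show ?thesis
    unfolding gauss_norm_def num_roots_def using assms(3,4) by simp
qed

text \<open>The number of roots in the open disk is the smallest index at which the Gauss norm is attained.\<close>

lemma gauss_norm_attained_monic:
  assumes "t > 0"
  defines "h \<equiv> \<lambda>A. \<Prod>\<sigma>\<in>#A. [:- \<sigma>, 1:]"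
  defines "N \<equiv> \<lambda>A. \<Prod>\<sigma>\<in>#A. max t (v \<sigma>)"
  defines "k \<equiv> \<lambda>A. size {#\<sigma>\<in>#A. v \<sigma> < t#}"
  shows "(\<forall>j. v (coeff (h A) j) * t ^ j \<le> N A) \<and> v (coeff (h A) (k A)) * t ^ k A = N A \<and>
    (\<forall>j<k A. v (coeff (h A) j) * t ^ j < N A)"
proof (induction A)
  case empty
  then show ?case using assms(1) by (auto simp: h_def N_def k_def coeff_1)
next
  case (add \<sigma> A)
  \<comment> \<open>\<open>u\<close> and, below, \<open>w\<close> are the weighted coefficients
    before and after multiplication by the new linear factor.\<close>
  define u where "u j = v (coeff (h A) j) * t ^ j" for j
  have Npos: "N A > 0" unfolding N_def using assms(1) by (induction A) auto
  have IH: "u j \<le> N A" "u (k A) = N A" "j < k A \<Longrightarrow> u j < N A" for j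
    using add by (auto simp: u_def)
  have c0: "coeff (h (add_mset \<sigma> A)) 0 = - \<sigma> * coeff (h A) 0"
    and cS: "coeff (h (add_mset \<sigma> A)) (Suc j) = coeff (h A) j + - \<sigma> * coeff (h A) (Suc j)" for j
    by (simp_all add: h_def)
  have N': "N (add_mset \<sigma> A) = max t (v \<sigma>) * N A" by (simp add: N_def)
  define w where "w j = v (coeff (h (add_mset \<sigma> A)) j) * t ^ j" for j
  have w0: "w 0 = v \<sigma> * u 0" by (simp add: w_def c0 u_def mult)
  have vs: "v (- \<sigma> * coeff (h A) (Suc j)) * t ^ Suc j = v \<sigma> * u (Suc j)"
    "v (coeff (h A) j) * t ^ Suc j = t * u j" for j
    by (simp_all add: u_def mult)
  have tp: "t ^ Suc j > 0" for j using assms(1) by simp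
  have wS: "w (Suc j) \<le> max (t * u j) (v \<sigma> * u (Suc j))" for j
  proof -
    have "w (Suc j) \<le> max (v (coeff (h A) j)) (v (- \<sigma> * coeff (h A) (Suc j))) * t ^ Suc j"
      unfolding w_def cS by (intro mult_right_mono ultrametric) (use tp less_imp_le in blast)
    also have "\<dots> = max (t * u j) (v \<sigma> * u (Suc j))"
      using tp[of j] by (simp only: max_mult_distrib_right vs) simp
    finally show ?thesis .
  qed
  have wS1: "w (Suc j) = t * u j" if "v \<sigma> * u (Suc j) < t * u j" for j
  proof -
    have "v (- \<sigma> * coeff (h A) (Suc j)) < v (coeff (h A) j)"
      using that tp[of j] vs[of j] by (metis mult_less_cancel_right_pos)
    then show ?thesis unfolding w_def cS using abs_add_eq' vs by metis
  qed
  have wS2: "w (Suc j) = v \<sigma> * u (Suc j)" if "t * u j < v \<sigma> * u (Suc j)" for j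
  proof -
    have "v (coeff (h A) j) < v (- \<sigma> * coeff (h A) (Suc j))"
      using that tp[of j] vs[of j] by (metis mult_less_cancel_right_pos)
    then show ?thesis unfolding w_def cS using abs_add_eq vs by metis
  qed
  have le: "t * u j \<le> max t (v \<sigma>) * N A" "v \<sigma> * u j \<le> max t (v \<sigma>) * N A" for j
    using IH(1)[of j] assms(1) nonneg[of \<sigma>] nonneg[of "coeff (h A) j"]
    by (auto intro!: mult_mono simp: u_def)
  have all: "w j \<le> N (add_mset \<sigma> A)" for j
  proof (cases j)
    case (Suc i)
    then show ?thesis using wS[of i] le(1)[of i] le(2)[of "Suc i"] N' by simp
  qed (use w0 le N' in auto)
  have u0: "u j \<ge> 0" for j using assms(1) nonneg by (simp add: u_def)
  show ?case
  proof (cases "v \<sigma> < t")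
    \<comment> \<open>The term from \<open>x\<close> dominates, since
      \<open>v \<sigma> * u j < t * N A\<close> for all \<open>j\<close>; the smallest attaining
      index moves up by one.\<close>
    case True
    then have k': "k (add_mset \<sigma> A) = Suc (k A)" and Nt: "N (add_mset \<sigma> A) = t * N A"
      using N' by (auto simp: k_def max_def)
    have vlt: "v \<sigma> * u j < t * N A" for j
      using True IH(1)[of j] Npos nonneg[of \<sigma>] u0[of j]
      by (meson mult_left_mono mult_strict_right_mono order.strict_trans1)
    have "w (Suc (k A)) = t * N A" using wS1[of "k A"] vlt IH(2) by simp
    moreover have "w j < t * N A" if "j < Suc (k A)" for j
    proof (cases j)
      case (Suc i)
      then have "t * u i < t * N A" using IH(3)[of i] that assms(1) by simp
      then show ?thesis using wS[of i] vlt[of "Suc i"] Suc by auto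
    qed (use w0 vlt in auto)
    ultimately show ?thesis using all k' Nt by (auto simp: w_def)
  next
    \<comment> \<open>The term from \<open>- \<sigma>\<close> dominates or ties. A tie could cancel
      at indices beyond \<open>k A\<close>, but at \<open>k A\<close> the competing term, if there
      is one, is strictly smaller, so the smallest attaining index stays.\<close>
    case False
    then have k': "k (add_mset \<sigma> A) = k A" and Nt: "N (add_mset \<sigma> A) = v \<sigma> * N A"
      using N' by (auto simp: k_def max_def)
    have sp: "v \<sigma> > 0" using False assms(1) by linarith
    have tlt: "t * u j < v \<sigma> * N A" if "j < k A" for j
      using IH(3)[OF that] assms(1) False Npos
      by (meson mult_less_cancel_left_pos mult_right_mono not_le_imp_less order.strict_trans2 less_imp_le)
    have "w (k A) = v \<sigma> * N A"
      using w0 wS2[of "k A - 1"] tlt[of "k A - 1"] IH(2) by (cases "k A") auto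
    moreover have "w j < v \<sigma> * N A" if "j < k A" for j
    proof -
      have "v \<sigma> * u j < v \<sigma> * N A" using IH(3)[OF that] sp by simp
      then show ?thesis using w0 wS[of "j - 1"] tlt[of "j - 1"] that by (cases j) auto
    qed
    ultimately show ?thesis using all k' Nt by (auto simp: w_def)
  qed
qed

text \<open>Translating \<open>b\<close> to 0 turns each root \<open>\<rho>\<close> into
  \<open>\<rho> - b\<close>, and \<open>c j\<close> is a Taylor coefficient at \<open>b\<close>; the
  leading coefficient only scales the monic case.\<close>

lemma gauss_norm_attained:
  fixes g :: "'k poly" and b :: 'k and j :: nat
  assumes "t > 0"
  defines "c \<equiv> coeff (g \<circ>\<^sub>p [:b, 1:])"
  defines "k \<equiv> num_roots g (odisk b t)"
  shows "v (c j) * t ^ j \<le> gauss_norm g b t" "v (c k) * t ^ k = gauss_norm g b t"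
    "g \<noteq> 0 \<Longrightarrow> j < k \<Longrightarrow> v (c j) * t ^ j < gauss_norm g b t"
proof -
  define A where "A = image_mset (\<lambda>\<rho>. \<rho> - b) (proots g)"
  define N where "N = (\<Prod>\<sigma>\<in>#A. max t (v \<sigma>))"
  have "pcompose (\<Prod>x\<in>#B. [:-x, 1:]) [:b, 1:] = (\<Prod>x\<in>#B. [:-(x - b), 1:])" for B
  proof (induction B)
    case (add x B)
    have "[:-x, 1:] \<circ>\<^sub>p [:b, 1:] = [:-(x - b), 1:]" by (simp add: pcompose_pCons)
    then show ?case
      using add by (simp only: image_mset_add_mset prod_mset.add_mset pcompose_mult)
  qed (simp add: pcompose_1)
  then have "g \<circ>\<^sub>p [:b, 1:] = smult (lead_coeff g) (\<Prod>\<sigma>\<in>#A. [:-\<sigma>, 1:])"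
    by (subst poly_eq_prod_proots) (auto simp: pcompose_smult A_def image_mset.compositionality o_def)
  then have c: "c j = lead_coeff g * coeff (\<Prod>\<sigma>\<in>#A. [:-\<sigma>, 1:]) j" for j
    by (simp add: c_def)
  have k: "k = size {#\<sigma>\<in>#A. v \<sigma> < t#}"
    by (simp add: k_def num_roots_def A_def odisk_def filter_mset_image_mset)
  have norm_g: "gauss_norm g b t = v (lead_coeff g) * N"
    by (simp add: gauss_norm_def N_def A_def image_mset.compositionality o_def)
  note * = gauss_norm_attained_monic[OF assms(1), of A, folded k N_def]
  show "v (c j) * t ^ j \<le> gauss_norm g b t"
    using * by (auto simp: c norm_g mult mult.assoc intro!: mult_left_mono nonneg)
  show "v (c k) * t ^ k = gauss_norm g b t"
    using * by (simp add: c norm_g mult mult.assoc)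
  show "v (c j) * t ^ j < gauss_norm g b t" if "g \<noteq> 0" "j < k"
    using * that by (auto simp: c norm_g mult mult.assoc)
qed

text \<open>A non-archimedean Rouche theorem. At the index where \<open>g\<close> first attains its
  Gauss norm, \<open>f\<close> is too small to interfere, so \<open>f + g\<close> has the same Gauss
  norm and the same smallest attaining index.\<close>

lemma num_roots_dominated:
  assumes "t > 0" "gauss_norm f b t < gauss_norm g b t" "f + g \<noteq> 0" "g \<noteq> 0"
  shows "num_roots (f + g) (odisk b t) = num_roots g (odisk b t)"
proof -
  let ?a = "\<lambda>h j. v (coeff (h \<circ>\<^sub>p [:b, 1:]) j) * t ^ j"
  let ?k = "num_roots g (odisk b t)" and ?l = "num_roots (f + g) (odisk b t)"
  have tp: "t ^ j > 0" for j using assms(1) by simp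
  have add: "coeff ((f + g) \<circ>\<^sub>p [:b, 1:]) j = coeff (f \<circ>\<^sub>p [:b, 1:]) j + coeff (g \<circ>\<^sub>p [:b, 1:]) j" for j
    by (simp add: pcompose_add)
  note f = gauss_norm_attained[OF assms(1), where g = f and b = b]
    and g = gauss_norm_attained[OF assms(1), where g = g and b = b]
    and fg = gauss_norm_attained[OF assms(1), where g = "f + g" and b = b]
  have le: "?a (f + g) j \<le> max (?a f j) (?a g j)" for j
  proof -
    have "?a (f + g) j \<le> max (v (coeff (f \<circ>\<^sub>p [:b, 1:]) j)) (v (coeff (g \<circ>\<^sub>p [:b, 1:]) j)) * t ^ j"
      unfolding add by (intro mult_right_mono ultrametric) (use tp less_imp_le in blast)
    then show ?thesis using tp[of j] by (simp add: max_mult_distrib_right)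
  qed
  have k: "?a (f + g) ?k = gauss_norm g b t"
  proof -
    have "?a f ?k < ?a g ?k" using f(1)[of ?k] g(2) assms(2) by simp
    then have "v (coeff (f \<circ>\<^sub>p [:b, 1:]) ?k) < v (coeff (g \<circ>\<^sub>p [:b, 1:]) ?k)"
      using tp[of ?k] by (metis mult_less_cancel_right_pos)
    then show ?thesis using abs_add_eq g(2) by (simp add: add)
  qed
  have N: "gauss_norm (f + g) b t = gauss_norm g b t"
    using k fg(1)[of ?k] fg(2) le[of ?l] f(1)[of ?l] g(1)[of ?l] assms(2) by linarith
  show ?thesis
  proof (rule linorder_cases)
    assume "?l < ?k"
    then have "?a (f + g) ?l < gauss_norm g b t"
      using le[of ?l] f(1)[of ?l] g(3)[of ?l] assms by linarith
    then show ?thesis using fg(2) N by simp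
  next
    assume "?k < ?l"
    then show ?thesis using fg(3)[of ?k] assms(3) k N by simp
  qed
qed

end

section \<open>The logarithmic derivative on a circle\<close>

lemma pderiv_over_poly:
  fixes g :: "'k::alg_closed_field poly"
  assumes "poly g x \<noteq> 0"
  shows "poly (pderiv g) x / poly g x = (\<Sum>\<rho>\<in>#proots g. 1 / (x - \<rho>))"
proof -
  have *: "poly (pderiv (\<Prod>\<rho>\<in>#B. [:-\<rho>, 1:])) x =
    poly (\<Prod>\<rho>\<in>#B. [:-\<rho>, 1:]) x * (\<Sum>\<rho>\<in>#B. 1 / (x - \<rho>))" if "x \<notin># B" for B
    using that
  proof (induction B)
    case (add \<rho> B)
    then have "x \<noteq> \<rho>" by auto
    have "pderiv ([:-\<rho>, 1:] * h) = h + [:-\<rho>, 1:] * pderiv h" for h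
      unfolding pderiv_mult by (simp add: pderiv_pCons)
    then show ?case using add \<open>x \<noteq> \<rho>\<close>
      by (simp only: image_mset_add_mset prod_mset.add_mset) (simp add: field_simps)
  qed (simp add: pderiv_1)
  have nz: "g \<noteq> 0" using assms by auto
  have "x \<notin># proots g" using assms nz by simp
  note * = *[OF this]
  define h where "h = (\<Prod>\<rho>\<in>#proots g. [:-\<rho>, 1:])"
  have g: "g = smult (lead_coeff g) h" unfolding h_def by (rule poly_eq_prod_proots)
  have "poly (pderiv g) x = lead_coeff g * poly (pderiv h) x"
    by (subst g) (simp add: pderiv_smult)
  also have "\<dots> = lead_coeff g * poly h x * (\<Sum>\<rho>\<in>#proots g. 1 / (x - \<rho>))"
    using * by (simp add: h_def)
  also have "lead_coeff g * poly h x = poly g x" by (subst (2) g) simp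
  finally show ?thesis using assms by simp
qed

text \<open>The logarithmic derivative of \<open>X ^ n - c\<close> at \<open>\<sigma>\<close>
  evaluates the sum of \<open>1 / (\<sigma> - u)\<close>, and
  \<open>u / (u - \<sigma>) = 1 - \<sigma> / (\<sigma> - u)\<close>.\<close>

lemma sum_root_quotients:
  fixes z \<sigma> :: "'k::alg_closed_field"
  assumes "n > 0" "\<sigma> ^ n \<noteq> c"
  shows "(\<Sum>u\<in>#proots (monom 1 n - [:c:]). u / (u - \<sigma>)) = of_nat n * (c / (c - \<sigma> ^ n))"
proof -
  let ?X = "monom 1 n - [:c:] :: 'k poly"
  have X: "poly ?X x = x ^ n - c" for x by (simp add: poly_monom)
  have dX: "degree ?X = n"
    using degree_add_eq_left[of "[:- c:]" "monom 1 n"] assms(1)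
    by (simp add: degree_monom_eq diff_conv_add_uminus del: add_uminus_conv_diff)
  have nz: "?X \<noteq> 0" using dX assms(1) by auto
  have s: "(\<Sum>u\<in>#proots ?X. 1 / (\<sigma> - u)) = of_nat n * \<sigma> ^ (n - 1) / (\<sigma> ^ n - c)"
    using pderiv_over_poly[of ?X \<sigma>] assms
    by (simp add: X pderiv_diff pderiv_monom poly_monom)
  have "u / (u - \<sigma>) = 1 - \<sigma> * (1 / (\<sigma> - u))" if "u \<in># proots ?X" for u
  proof -
    have "u \<noteq> \<sigma>" using that nz X assms(2) by auto
    then show ?thesis by (simp add: divide_simps) (simp add: algebra_simps)
  qed
  then have "(\<Sum>u\<in>#proots ?X. u / (u - \<sigma>)) = (\<Sum>u\<in>#proots ?X. 1 - \<sigma> * (1 / (\<sigma> - u)))"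
    by (intro arg_cong[of _ _ sum_mset] image_mset_cong)
  also have "\<dots> = of_nat n - \<sigma> * (\<Sum>u\<in>#proots ?X. 1 / (\<sigma> - u))"
  proof -
    have "(\<Sum>u\<in>#B. 1 - \<sigma> * (1 / (\<sigma> - u))) = of_nat (size B) - \<sigma> * (\<Sum>u\<in>#B. 1 / (\<sigma> - u))" for B
      by (induction B) (auto simp: algebra_simps)
    then show ?thesis using dX by simp
  qed
  also have "\<dots> = of_nat n - of_nat n * \<sigma> ^ n / (\<sigma> ^ n - c)"
    using assms(1) by (simp add: s power_eq_if[of \<sigma> n] mult_ac)
  also have "\<dots> = of_nat n * (c / (c - \<sigma> ^ n))"
    using assms(2) by (simp add: divide_simps) (simp add: algebra_simps)
  finally show ?thesis .
qed

context alg_closed_nonarch_abs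
begin

lemma abs_sum_mset_less: "B > 0 \<Longrightarrow> (\<And>x. x \<in># A \<Longrightarrow> v (f x) < B) \<Longrightarrow> v (\<Sum>x\<in>#A. f x) < B"
proof (induction A)
  case (add x A)
  then show ?case using ultrametric[of "f x" "\<Sum>x\<in>#A. f x"] by fastforce
qed simp

text \<open>Minus the numerator of \<open>(p / q)'\<close>; its zeros away from those of
  \<open>q\<close> are critical points of \<open>p / q\<close>.\<close>

definition wronskian :: "'k poly \<Rightarrow> 'k poly \<Rightarrow> 'k poly" where
  "wronskian p q = p * pderiv q - pderiv p * q"

text \<open>If \<open>p / q\<close> behaves like \<open>x ^ m\<close> on the circle of radius \<open>v z\<close>, then the Laurent expansion of
  its logarithmic derivative \<open>x (p / q)' / (p / q)\<close> has constant term \<open>m\<close>. The averages over the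
  roots of \<open>u ^ n = z ^ n\<close>, where \<open>n\<close> is large and has absolute value 1, isolate that term.\<close>

lemma abs_slope_le:
  assumes nz: "p \<noteq> 0" "q \<noteq> 0" "z \<noteq> 0"
    and circ: "\<And>x. v (x - b) = v z \<Longrightarrow> poly p x \<noteq> 0 \<and> poly q x \<noteq> 0"
    and m: "num_roots p (odisk b (v z)) = num_roots q (odisk b (v z)) + m"
  shows "v (of_nat m) \<le> v z * gauss_norm (wronskian p q) b (v z) / (gauss_norm p b (v z) * gauss_norm q b (v z))"
    (is "_ \<le> ?G")
proof (cases "of_nat m = (0 :: 'k)")
  \<comment> \<open>If \<open>m\<close> vanishes in the field, the left side is 0. The error
    estimates of the other case need a positive bound.\<close>
  case True
  have "gauss_norm (wronskian p q) b (v z) \<ge> 0"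
    using nonneg abs_poly_le_gauss_norm[of "wronskian p q" "z + b" b] by (metis add_diff_cancel_right' order_trans)
  then show ?thesis using True gauss_norm_pos[of p "v z" b] gauss_norm_pos[of q "v z" b] nz
    by (simp add: nonneg zero_le_divide_iff)
next
  case m0: False
  let ?t = "v z"
  have t: "?t > 0" using nz by simp
  \<comment> \<open>Up to the factor \<open>n\<close>, the sum of
    \<open>u / (u - (\<rho> - b))\<close> over \<open>u ^ n = z ^ n\<close> is
    \<open>z ^ n / (z ^ n - (\<rho> - b) ^ n)\<close>. Its limit for large \<open>n\<close> is
    \<open>ind \<rho>\<close>, which is 1 for roots inside the circle and 0 outside;
    \<open>e n \<rho>\<close> is the error.\<close>
  define ind where "ind \<rho> = (if \<rho> \<in> odisk b ?t then 1 else 0 :: 'k)" for \<rho>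
  define e where "e n \<rho> = z ^ n / (z ^ n - (\<rho> - b) ^ n) - ind \<rho>" for n \<rho>
  define S where "S = {x. poly p x = 0 \<or> poly q x = 0}"
  have S: "finite S" unfolding S_def using nz(1,2)[THEN poly_roots_finite] by (simp add: Collect_disj_eq)
  have Sne: "v (\<rho> - b) \<noteq> ?t" if "\<rho> \<in> S" for \<rho> using that circ unfolding S_def by auto
  have pw: "z ^ n \<noteq> (\<rho> - b) ^ n" if "\<rho> \<in> S" "n > 0" for n \<rho>
  proof
    assume "z ^ n = (\<rho> - b) ^ n"
    then have "?t ^ n = v (\<rho> - b) ^ n" by (simp flip: abs_power)
    then have "?t = v (\<rho> - b)" using power_eq_imp_eq_base nonneg that(2) by blast
    then show False using Sne[OF that(1)] by simp
  qed
  have "\<forall>\<^sub>F n in sequentially. v (e n \<rho>) < v (of_nat m)" if "\<rho> \<in> S" for \<rho>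
  proof -
    \<comment> \<open>The quotient of the smaller by the larger of \<open>v (\<rho> - b)\<close> and
      \<open>?t\<close>; the size of the error is exactly its \<open>n\<close>-th power.\<close>
    define x where "x = (if v (\<rho> - b) < ?t then v (\<rho> - b) / ?t else ?t / v (\<rho> - b))"
    have x: "0 \<le> x" "x < 1" using Sne[OF that] t nonneg[of "\<rho> - b"]
      by (auto simp: x_def divide_less_eq not_less simp del: abs_pos)
    have ve: "v (e n \<rho>) = x ^ n" if "n > 0" for n
    proof (cases "v (\<rho> - b) < ?t")
      case True
      have "e n \<rho> = (\<rho> - b) ^ n / (z ^ n - (\<rho> - b) ^ n)"
        using pw[OF \<open>\<rho> \<in> S\<close> that] True by (simp add: e_def ind_def odisk_def divide_simps)
      moreover have "v (- ((\<rho> - b) ^ n)) < v (z ^ n)"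
        using True that nonneg by (simp add: abs_power power_strict_mono)
      then have "v (z ^ n - (\<rho> - b) ^ n) = v (z ^ n)"
        using abs_add_eq'[of "- ((\<rho> - b) ^ n)" "z ^ n"] by simp
      ultimately show ?thesis using True by (simp add: abs_divide abs_power x_def power_divide)
    next
      case False
      then have gt: "?t < v (\<rho> - b)" using Sne[OF \<open>\<rho> \<in> S\<close>] by simp
      have "v (z ^ n) < v (- ((\<rho> - b) ^ n))"
        using gt that nonneg by (simp add: abs_power power_strict_mono)
      then have "v (z ^ n - (\<rho> - b) ^ n) = v ((\<rho> - b) ^ n)"
        using abs_add_eq[of "z ^ n" "- ((\<rho> - b) ^ n)"] by simp
      then show ?thesis using False
        by (simp add: e_def ind_def odisk_def abs_divide abs_power x_def power_divide)
    qed
    have "(\<lambda>n. x ^ n) \<longlonglongrightarrow> 0" using x by (intro LIMSEQ_power_zero) simp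
    then have "\<forall>\<^sub>F n in sequentially. x ^ n < v (of_nat m)"
      by (rule order_tendstoD) (use m0 in simp)
    then show ?thesis
      using eventually_gt_at_top[of "0 :: nat"] by eventually_elim (simp add: ve)
  qed
  then have "\<forall>\<^sub>F n in sequentially. \<forall>\<rho>\<in>S. v (e n \<rho>) < v (of_nat m)"
    using S by (simp add: eventually_ball_finite)
  then obtain n0 where n0: "\<And>n \<rho>. n \<ge> n0 \<Longrightarrow> \<rho> \<in> S \<Longrightarrow> v (e n \<rho>) < v (of_nat m)"
    by (auto simp: eventually_sequentially)
  \<comment> \<open>Of two consecutive integers at least one has absolute value 1, since neither
    exceeds 1 in absolute value and they differ by 1.\<close>
  obtain n where n: "n > 0" "n \<ge> n0" "v (of_nat n) = 1"
  proof -
    have "v (of_nat (Suc n0)) = 1 \<or> v (of_nat (Suc (Suc n0))) = 1"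
      using abs_of_nat_le_1[of "Suc n0"] abs_of_nat_le_1[of "Suc (Suc n0)"]
        abs_diff_le[of "of_nat (Suc (Suc n0))" "of_nat (Suc n0)"] by auto
    then show ?thesis using that[of "Suc n0"] that[of "Suc (Suc n0)"] by auto
  qed
  define A where "A = proots (monom 1 n - [:z ^ n:] :: 'k poly)"
  have vA: "v u = ?t" if "u \<in># A" for u
  proof -
    have "monom 1 n - [:z ^ n:] \<noteq> 0" using that by (auto simp: A_def)
    then have "u ^ n = z ^ n" using that by (simp add: A_def poly_monom)
    then have "v u ^ n = ?t ^ n" by (simp flip: abs_power)
    then show ?thesis using power_eq_imp_eq_base nonneg n(1) by blast
  qed
  \<comment> \<open>Expand in partial fractions, exchange the two sums, and evaluate the inner one
    by \<open>sum_root_quotients\<close>.\<close>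
  have logder: "(\<Sum>u\<in>#A. u * (poly (pderiv g) (u + b) / poly g (u + b))) =
    of_nat n * (of_nat (num_roots g (odisk b ?t)) + (\<Sum>\<rho>\<in>#proots g. e n \<rho>))"
    if g: "g = p \<or> g = q" for g
  proof -
    have gS: "\<rho> \<in> S" if "\<rho> \<in># proots g" for \<rho>
      using that g nz by (auto simp: S_def)
    have "(\<Sum>u\<in>#A. u * (poly (pderiv g) (u + b) / poly g (u + b))) =
      (\<Sum>u\<in>#A. \<Sum>\<rho>\<in>#proots g. u / (u - (\<rho> - b)))"
    proof (intro arg_cong[of _ _ sum_mset] image_mset_cong)
      fix u assume "u \<in># A"
      then have "poly g (u + b) \<noteq> 0" using circ[of "u + b"] vA g by auto
      from pderiv_over_poly[OF this]
      show "u * (poly (pderiv g) (u + b) / poly g (u + b)) = (\<Sum>\<rho>\<in>#proots g. u / (u - (\<rho> - b)))"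
        by (simp add: sum_mset_distrib_left algebra_simps)
    qed
    also have "\<dots> = (\<Sum>\<rho>\<in>#proots g. \<Sum>u\<in>#A. u / (u - (\<rho> - b)))"
      by (rule sum_mset.swap)
    also have "\<dots> = (\<Sum>\<rho>\<in>#proots g. of_nat n * (ind \<rho> + e n \<rho>))"
    proof (intro arg_cong[of _ _ sum_mset] image_mset_cong)
      fix \<rho> assume "\<rho> \<in># proots g"
      then have "z ^ n \<noteq> (\<rho> - b) ^ n" using pw gS n(1) by blast
      then show "(\<Sum>u\<in>#A. u / (u - (\<rho> - b))) = of_nat n * (ind \<rho> + e n \<rho>)"
        unfolding A_def using n(1) by (subst sum_root_quotients) (auto simp: e_def)
    qed
    also have "\<dots> = of_nat n * ((\<Sum>\<rho>\<in>#proots g. ind \<rho>) + (\<Sum>\<rho>\<in>#proots g. e n \<rho>))"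
      by (simp add: sum_mset.distrib flip: sum_mset_distrib_left)
    also have "(\<Sum>\<rho>\<in>#proots g. ind \<rho>) = of_nat (num_roots g (odisk b ?t))"
    proof -
      have "(\<Sum>\<rho>\<in>#B. ind \<rho>) = of_nat (size {#x \<in># B. x \<in> odisk b ?t#})" for B
        by (induction B) (auto simp: ind_def)
      then show ?thesis by (simp add: num_roots_def)
    qed
    finally show ?thesis .
  qed
  define E where "E = (\<Sum>\<rho>\<in>#proots p. e n \<rho>) - (\<Sum>\<rho>\<in>#proots q. e n \<rho>)"
  have le: "v (\<Sum>\<rho>\<in>#proots g. e n \<rho>) < v (of_nat m)" if "g = p \<or> g = q" for g
  proof (rule abs_sum_mset_less)
    fix \<rho> assume "\<rho> \<in># proots g"
    then show "v (e n \<rho>) < v (of_nat m)"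
      using that nz by (intro n0[OF n(2)]) (auto simp: S_def)
  qed (use m0 in simp)
  have E: "v E < v (of_nat m)"
    unfolding E_def using abs_diff_le le[of p] le[of q] by (smt (verit, best))
  \<comment> \<open>\<open>R u\<close> is \<open>u\<close> times the logarithmic derivative of
    \<open>p / q\<close> at \<open>u + b\<close>. In its sum over \<open>A\<close> the root counts
    leave \<open>m\<close>, and \<open>E\<close> is too small to change the absolute value.\<close>
  define R where "R u = u * (poly (pderiv p) (u + b) / poly p (u + b)) -
    u * (poly (pderiv q) (u + b) / poly q (u + b))" for u
  have "(\<Sum>u\<in>#A. R u) = of_nat n * (of_nat m + E)"
  proof -
    have *: "(\<Sum>u\<in>#B. R u) = (\<Sum>u\<in>#B. u * (poly (pderiv p) (u + b) / poly p (u + b))) -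
      (\<Sum>u\<in>#B. u * (poly (pderiv q) (u + b) / poly q (u + b)))" for B
      by (induction B) (simp_all add: R_def algebra_simps)
    show ?thesis unfolding * logder[OF disjI1[OF refl]] logder[OF disjI2[OF refl]]
      by (simp add: m E_def algebra_simps)
  qed
  then have "v (of_nat m) = v (\<Sum>u\<in>#A. R u)"
    using n(3) E abs_add_eq' by (simp add: mult)
  also have "\<dots> \<le> ?G"
  proof (rule abs_sum_mset_le)
    have "v (R u) \<le> ?G" if "v u = ?t" for u
    proof -
      have nz': "poly p (u + b) \<noteq> 0" "poly q (u + b) \<noteq> 0" using circ[of "u + b"] that by auto
      then have "R u = - (u * poly (wronskian p q) (u + b)) / (poly p (u + b) * poly q (u + b))"
        unfolding R_def wronskian_def by (simp add: divide_simps) (simp add: algebra_simps)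
      then have "v (R u) = ?t * v (poly (wronskian p q) (u + b)) / (v (poly p (u + b)) * v (poly q (u + b)))"
        using that by (simp add: abs_divide mult)
      moreover have "v (poly g (u + b)) = gauss_norm g b ?t" if g: "g = p \<or> g = q" for g
      proof (rule abs_poly_eq_gauss_norm)
        \<comment> \<open>The open disk of radius \<open>?t\<close> around \<open>u + b\<close>
          stays on the circle, where \<open>p\<close> and \<open>q\<close> have no roots, so both
          attain their Gauss norms.\<close>
        fix y assume y: "y \<in> odisk (u + b) ?t"
        have "v (y - b) = ?t"
          using abs_add_eq[of "y - (u + b)" u] y \<open>v u = ?t\<close> by (simp add: odisk_def algebra_simps)
        then show "poly g y \<noteq> 0" using circ g by auto
      qed (use that \<open>v u = ?t\<close> nz in auto)
      moreover have "v (poly (wronskian p q) (u + b)) \<le> gauss_norm (wronskian p q) b ?t"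
        using abs_poly_le_gauss_norm[of "wronskian p q" "u + b" b] that by simp
      ultimately show ?thesis
        using gauss_norm_pos[of p ?t b] gauss_norm_pos[of q ?t b] nz t by (auto intro!: divide_right_mono mult_left_mono simp: nonneg)
    qed
    then show "\<And>u. u \<in># A \<Longrightarrow> v (R u) \<le> ?G" using vA by blast
    from \<open>\<And>u. v u = ?t \<Longrightarrow> v (R u) \<le> ?G\<close>[of z] show "0 \<le> ?G" using nonneg order_trans by blast
  qed
  finally show ?thesis .
qed

end

section \<open>The descent through disks\<close>

lemma degree_pderiv_le: "degree (pderiv f) \<le> degree f - 1"
  by (rule degree_le) (auto simp: coeff_pderiv coeff_eq_0)

text \<open>Here \<open>p / q\<close> is \<open>\<phi> - a\<close>, with \<open>\<infinity>\<close> as the fixed point. The assumption \<open>slope\<close> is the bound on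
  the directional degrees: \<open>\<phi>\<close> is \<open>m\<close>-to-\<open>1\<close> on the annulus \<open>{x. s < v (x - b) < e}\<close>.\<close>

locale attracting_infinity = alg_closed_nonarch_abs v
  for v :: "'k::alg_closed_field \<Rightarrow> real" +
  fixes p q :: "'k poly" and d :: nat and L :: real and a :: 'k and r :: real
  assumes deg: "degree p = d" "Suc (degree q) = d" "d \<ge> 2"
    and no_common_root: "\<And>x. poly p x = 0 \<Longrightarrow> poly q x \<noteq> 0"
    and char: "\<And>m. 0 < m \<Longrightarrow> m \<le> d \<Longrightarrow> of_nat m \<noteq> (0 :: 'k)"
    and L: "L = v (lead_coeff q) / v (lead_coeff p)" "L < 1"
    and a: "poly q a = 0"
    and r: "r > 0" "\<And>x. poly p x = 0 \<or> poly q x = 0 \<Longrightarrow> v (x - a) \<le> r"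
      "\<exists>x. (poly p x = 0 \<or> poly q x = 0) \<and> v (x - a) = r"
    and slope: "\<And>b s e m. 0 < s \<Longrightarrow> s < e \<Longrightarrow> 0 < m \<Longrightarrow>
      (\<And>x. s < v (x - b) \<Longrightarrow> v (x - b) < e \<Longrightarrow> poly p x \<noteq> 0 \<and> poly q x \<noteq> 0) \<Longrightarrow>
      num_roots p (odisk b e) = num_roots q (odisk b e) + m \<Longrightarrow> L < v (of_nat m) ^ d"
begin

definition W :: "'k poly" where "W = wronskian p q"

lemma nz [simp]: "p \<noteq> 0" "q \<noteq> 0"
  using deg a no_common_root[of a] by auto

lemma L_pos: "L > 0" using L by simp

text \<open>The coefficients of degree \<open>2 * d - 2\<close> in \<open>p * pderiv q\<close> and
  \<open>pderiv p * q\<close> are \<open>d - 1\<close> and \<open>d\<close> times the product of the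
  leading coefficients; their difference is minus this product in every characteristic.\<close>

lemma W_deg: "degree W = 2 * d - 2" "lead_coeff W = - (lead_coeff p * lead_coeff q)" "W \<noteq> 0"
proof -
  have dq: "degree q = d - 1" using deg by simp
  have *: "degree (p * pderiv q) \<le> 2 * d - 2"
    using degree_mult_le[of p "pderiv q"] degree_pderiv_le[of q] deg by linarith
  have **: "degree (pderiv p * q) \<le> 2 * d - 2"
    using degree_mult_le[of "pderiv p" q] degree_pderiv_le[of p] deg dq by simp
  have le: "degree W \<le> 2 * d - 2"
    unfolding W_def wronskian_def by (rule degree_diff_le[OF * **])
  have c1: "coeff (p * pderiv q) (2 * d - 2) = of_nat (d - 1) * (lead_coeff p * lead_coeff q)"
  proof -
    have "coeff (p * pderiv q) (d + (d - 2)) = (\<Sum>i\<le>d + (d - 2). coeff p i * coeff (pderiv q) (d + (d - 2) - i))"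
      by (rule coeff_mult)
    also have "\<dots> = (\<Sum>i\<in>{d}. coeff p i * coeff (pderiv q) (d + (d - 2) - i))"
    proof (rule sum.mono_neutral_right)
      show "\<forall>i\<in>{..d + (d - 2)} - {d}. coeff p i * coeff (pderiv q) (d + (d - 2) - i) = 0"
      proof
        fix i assume "i \<in> {..d + (d - 2)} - {d}"
        then consider "i > d" | "i < d" by fastforce
        then show "coeff p i * coeff (pderiv q) (d + (d - 2) - i) = 0"
        proof cases
          case 2
          then have "Suc (d + (d - 2) - i) > degree q" using dq by simp
          then show ?thesis by (simp add: coeff_pderiv coeff_eq_0)
        qed (simp add: coeff_eq_0 deg)
      qed
    qed auto
    also have "\<dots> = of_nat (d - 1) * (lead_coeff p * lead_coeff q)"
      using deg dq by (simp add: coeff_pderiv Suc_diff_Suc numeral_2_eq_2)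
    finally show ?thesis using deg(3) by (simp add: mult_2)
  qed
  have c2: "coeff (pderiv p * q) (2 * d - 2) = of_nat d * (lead_coeff p * lead_coeff q)"
  proof -
    have "coeff (q * pderiv p) ((d - 1) + (d - 1)) = (\<Sum>i\<le>(d - 1) + (d - 1). coeff q i * coeff (pderiv p) ((d - 1) + (d - 1) - i))"
      by (rule coeff_mult)
    also have "\<dots> = (\<Sum>i\<in>{d - 1}. coeff q i * coeff (pderiv p) ((d - 1) + (d - 1) - i))"
    proof (rule sum.mono_neutral_right)
      show "\<forall>i\<in>{..(d - 1) + (d - 1)} - {d - 1}. coeff q i * coeff (pderiv p) ((d - 1) + (d - 1) - i) = 0"
      proof
        fix i assume "i \<in> {..(d - 1) + (d - 1)} - {d - 1}"
        then consider "i > d - 1" | "i < d - 1" by fastforce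
        then show "coeff q i * coeff (pderiv p) ((d - 1) + (d - 1) - i) = 0"
        proof cases
          case 2
          then have "Suc ((d - 1) + (d - 1) - i) > degree p" using deg by simp
          then show ?thesis by (simp add: coeff_pderiv coeff_eq_0)
        qed (simp add: coeff_eq_0 dq)
      qed
    qed auto
    also have "\<dots> = of_nat d * (lead_coeff p * lead_coeff q)"
      using deg dq by (simp add: coeff_pderiv)
    finally have "coeff (q * pderiv p) ((d - 1) + (d - 1)) = of_nat d * (lead_coeff p * lead_coeff q)" .
    moreover have "(d - 1) + (d - 1) = 2 * d - 2" by simp
    ultimately show ?thesis by (metis mult.commute)
  qed
  have "coeff W (2 * d - 2) = - (lead_coeff p * lead_coeff q)"
  proof -
    have "of_nat d = of_nat (d - 1) + (1 :: 'k)" using deg(3) by (cases d) auto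
    then show ?thesis unfolding W_def wronskian_def coeff_diff c1 c2 by (simp add: algebra_simps)
  qed
  moreover from this have "degree W = 2 * d - 2" using le le_degree[of W "2 * d - 2"] by simp
  ultimately show "degree W = 2 * d - 2" "lead_coeff W = - (lead_coeff p * lead_coeff q)" "W \<noteq> 0"
    by auto
qed

text \<open>At a root of \<open>q\<close> of order \<open>m\<close>, the polynomial \<open>W\<close>
  agrees with \<open>p * pderiv q\<close> modulo the \<open>m\<close>-th power of the linear factor,
  and \<open>pderiv q\<close> has order exactly \<open>m - 1\<close> because
  \<open>m \<le> d\<close> is nonzero in the field.\<close>

lemma order_W_pole:
  assumes "poly q x = 0"
  shows "order x W < order x q"
proof -
  define m where "m = order x q"
  have m: "m > 0" using assms by (simp add: m_def order_gt_0_iff)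
  have md: "m \<le> d" using order_degree[of q x] deg by (simp add: m_def)
  obtain h where h: "q = [:-x, 1:] ^ m * h" "poly h x \<noteq> 0"
    using order_decomp[of q x] unfolding m_def by (auto simp: poly_eq_0_iff_dvd)
  show ?thesis
  proof (rule ccontr)
    assume "\<not> order x W < order x q"
    then have "[:-x, 1:] ^ m dvd W" by (simp add: m_def order_divides)
    moreover have "[:-x, 1:] ^ m dvd pderiv p * q" using h by simp
    ultimately have "[:-x, 1:] ^ m dvd p * pderiv q"
      unfolding W_def wronskian_def by (metis diff_add_cancel dvd_add)
    moreover have "p * pderiv q = [:-x, 1:] ^ m * (p * pderiv h) +
      [:-x, 1:] ^ (m - 1) * (p * smult (of_nat m) h)"
    proof -
      have "pderiv ([:-x, 1:] ^ Suc (m - 1)) = smult (of_nat m) ([:-x, 1:] ^ (m - 1))"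
        using m by (subst pderiv_power_Suc) (simp add: pderiv_pCons of_nat_diff)
      then have "pderiv q = [:-x, 1:] ^ m * pderiv h + h * smult (of_nat m) ([:-x, 1:] ^ (m - 1))"
        using m h(1) by (simp add: pderiv_mult)
      then show ?thesis by (simp add: algebra_simps)
    qed
    ultimately have "[:-x, 1:] ^ m dvd [:-x, 1:] ^ (m - 1) * (p * smult (of_nat m) h)"
      by (metis dvd_add_right_iff dvd_triv_left)
    moreover have "[:-x, 1:] ^ m = [:-x, 1:] ^ (m - 1) * [:-x, 1:]"
      using m by (metis power_minus_mult)
    moreover have "[:-x, 1:] ^ (m - 1) \<noteq> 0" by simp
    ultimately have "[:-x, 1:] dvd p * smult (of_nat m) h"
      by (metis dvd_mult_cancel_left)
    then have "poly p x * (of_nat m * poly h x) = 0" by (auto simp flip: poly_eq_0_iff_dvd)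
    then show False using h(2) char[OF m md] no_common_root[of x] assms by (metis mult_eq_0_iff)
  qed
qed

text \<open>In Gauss norms at \<open>\<zeta>(b,t)\<close>, \<open>F\<close> is the size of \<open>p / q\<close> and \<open>G\<close> that of \<open>t (p / q)' / (p / q)\<close>.\<close>

definition F where "F b t = gauss_norm p b t / gauss_norm q b t"
definition G where "G b t = t * gauss_norm W b t / (gauss_norm p b t * gauss_norm q b t)"

lemma gauss_norms_pos [simp]: "t > 0 \<Longrightarrow> gauss_norm p b t > 0" "t > 0 \<Longrightarrow> gauss_norm q b t > 0" "t > 0 \<Longrightarrow> gauss_norm W b t > 0"
  by (simp_all add: gauss_norm_pos W_deg)

lemma F_pos: "t > 0 \<Longrightarrow> F b t > 0" by (simp add: F_def)
lemma FG_recentre: "v (x - b) \<le> t \<Longrightarrow> F x t = F b t" "v (x - b) \<le> t \<Longrightarrow> G x t = G b t"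
  by (simp_all add: F_def G_def gauss_norm_recentre)

section \<open>The descent, assuming that no finite critical value has absolute value above
  \<open>r\<close>\<close>

context
  assumes no_crit: "\<And>x. poly W x = 0 \<Longrightarrow> poly q x \<noteq> 0 \<Longrightarrow> v (poly p x) \<le> r * v (poly q x)"
begin

text \<open>At such an \<open>x\<close> the quotient \<open>p / q\<close> has absolute value
  \<open>F b t > r\<close>, which \<open>no_crit\<close> forbids at a zero of
  \<open>W\<close>.\<close>

lemma W_nonzero:
  assumes "t > 0" "v (x - b) \<le> t" "F b t > r"
    "\<And>y. y \<in> odisk x t \<Longrightarrow> poly p y \<noteq> 0 \<and> poly q y \<noteq> 0"
  shows "poly W x \<noteq> 0"
proof
  assume W: "poly W x = 0"
  have "v (poly p x) = gauss_norm p b t" "v (poly q x) = gauss_norm q b t"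
    using assms by (auto intro!: abs_poly_eq_gauss_norm)
  moreover have "poly q x \<noteq> 0" using assms(1) assms(4)[of x] by (simp add: odisk_def)
  ultimately have "gauss_norm p b t \<le> r * gauss_norm q b t" using no_crit[OF W] by simp
  then show False using assms(1,3) by (simp add: F_def field_simps)
qed

text \<open>This is \<open>W_nonzero\<close> on the circle through \<open>x\<close>: the open disk
  around \<open>x\<close> of radius \<open>v (x - b)\<close> does not leave that circle.\<close>

lemma W_nonzero_annulus:
  assumes "s1 < v (x - b)" "v (x - b) < s" "0 < v (x - b)" "F b (v (x - b)) > r"
    "\<And>y. s1 < v (y - b) \<Longrightarrow> v (y - b) < s \<Longrightarrow> poly p y \<noteq> 0 \<and> poly q y \<noteq> 0"
  shows "poly W x \<noteq> 0"
proof (rule W_nonzero[OF assms(3) order_refl assms(4)])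
  fix y assume "y \<in> odisk x (v (x - b))"
  then have "v (y - b) = v (x - b)"
    using abs_add_eq[of "y - x" "x - b"] by (simp add: odisk_def)
  then show "poly p y \<noteq> 0 \<and> poly q y \<noteq> 0" using assms by metis
qed

text \<open>The quantity \<open>num_roots W - num_roots p - num_roots q\<close> is additive over the residue classes
  of a closed disk and vanishes on the classes without roots of \<open>p\<close> and \<open>q\<close>.\<close>

lemma split_closed_disk:
  assumes "s > 0" "F b s > r"
    and roots: "poly p x = 0 \<or> poly q x = 0" "v (x - b) \<le> s"
      "poly p y = 0 \<or> poly q y = 0" "v (y - b) \<le> s" "v (x - y) \<ge> s"
    and count: "num_roots p (cdisk b s) + num_roots q (cdisk b s) \<le> num_roots W (cdisk b s) + 1"
  obtains z where "poly p z = 0 \<or> poly q z = 0" "v (z - b) \<le> s"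
    "num_roots p (odisk z s) + num_roots q (odisk z s) \<le> num_roots W (odisk z s)"
proof -
  define R where "R = {z. (poly p z = 0 \<or> poly q z = 0) \<and> v (z - b) \<le> s}"
  \<comment> \<open>The residue classes of the closed disk that contain a root of \<open>p\<close>
    or \<open>q\<close>. By \<open>W_nonzero\<close>, the roots of \<open>W\<close> in the closed
    disk lie in them as well.\<close>
  define \<D> where "\<D> = (\<lambda>z. odisk z s) ` R"
  have "finite R"
    using nz[THEN poly_roots_finite] by (auto simp: R_def intro: finite_subset[of _ "{z. poly p z = 0} \<union> {z. poly q z = 0}"])
  then have fin: "finite \<D>" by (simp add: \<D>_def)
  have disj: "disjoint \<D>"
  proof (rule disjointI, rule ccontr)
    fix D E assume DE: "D \<in> \<D>" "E \<in> \<D>" "D \<noteq> E" "D \<inter> E \<noteq> {}"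
    then obtain w y z where "w \<in> D" "w \<in> E" "D = odisk y s" "E = odisk z s"
      by (auto simp: \<D>_def)
    then have "D = E" using odisk_recentre[of w y s] odisk_recentre[of w z s] by simp
    with DE(3) show False ..
  qed
  have sub: "D \<subseteq> cdisk b s" if D: "D \<in> \<D>" for D
  proof
    fix w assume "w \<in> D"
    then obtain z where "v (w - z) < s" "v (z - b) \<le> s"
      using D by (auto simp: \<D>_def R_def odisk_def)
    then show "w \<in> cdisk b s" using abs_triangle[of w b z] by (simp add: cdisk_def)
  qed
  have self: "z \<in> odisk z s" for z using assms(1) by (simp add: odisk_def)
  have cnt: "num_roots g (cdisk b s) = (\<Sum>D\<in>\<D>. num_roots g D)"
    if "g \<noteq> 0" "\<And>z. poly g z = 0 \<Longrightarrow> z \<in> cdisk b s \<Longrightarrow> z \<in> \<Union>\<D>" for g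
  proof -
    have "num_roots g (cdisk b s) = num_roots g (\<Union>\<D>)"
      by (rule num_roots_cong) (use that sub in auto)
    then show ?thesis using num_roots_UN[OF that(1) fin disj] by simp
  qed
  have cp: "num_roots p (cdisk b s) = (\<Sum>D\<in>\<D>. num_roots p D)"
    using self by (intro cnt) (auto simp: \<D>_def R_def cdisk_def)
  have cq: "num_roots q (cdisk b s) = (\<Sum>D\<in>\<D>. num_roots q D)"
    using self by (intro cnt) (auto simp: \<D>_def R_def cdisk_def)
  have cW: "num_roots W (cdisk b s) = (\<Sum>D\<in>\<D>. num_roots W D)"
  proof (intro cnt)
    fix z assume z: "poly W z = 0" "z \<in> cdisk b s"
    then obtain y where "y \<in> odisk z s" "poly p y = 0 \<or> poly q y = 0"
      using W_nonzero[of s z b] assms(1,2) by (auto simp: cdisk_def)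
    moreover from this have "v (y - b) \<le> s"
      using z(2) abs_triangle[of y b z] by (auto simp: odisk_def cdisk_def)
    ultimately show "z \<in> \<Union>\<D>"
      using odisk_recentre[of y z s] self[of z] by (auto simp: \<D>_def R_def)
  qed (simp add: W_deg)
  note found = that
  show ?thesis
  proof (rule ccontr)
    assume no: "\<not> thesis"
    \<comment> \<open>If no class works, each one has a deficit of at least one root of
      \<open>W\<close>. Since \<open>x\<close> and \<open>y\<close> lie in different classes, the
      total deficit is at least 2, against \<open>count\<close>.\<close>
    have "num_roots W D + 1 \<le> num_roots p D + num_roots q D" if "D \<in> \<D>" for D
    proof -
      from that obtain z where z: "z \<in> R" "D = odisk z s" by (auto simp: \<D>_def)
      then have "\<not> num_roots p (odisk z s) + num_roots q (odisk z s) \<le> num_roots W (odisk z s)"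
        using found[of z] no by (auto simp: R_def)
      then show ?thesis using z by simp
    qed
    then have "(\<Sum>D\<in>\<D>. num_roots W D + 1) \<le> (\<Sum>D\<in>\<D>. num_roots p D + num_roots q D)"
      by (rule sum_mono)
    then have "num_roots W (cdisk b s) + card \<D> \<le> num_roots p (cdisk b s) + num_roots q (cdisk b s)"
      unfolding cp cq cW by (simp only: sum.distrib) simp
    moreover have "card \<D> \<ge> 2"
    proof -
      have "{odisk x s, odisk y s} \<subseteq> \<D>" using roots by (auto simp: \<D>_def R_def)
      moreover have "x \<notin> odisk y s" using roots(5) by (simp add: odisk_def)
      then have "odisk x s \<noteq> odisk y s" using self[of x] by blast
      ultimately show ?thesis using card_mono[OF fin, of "{odisk x s, odisk y s}"] by simp
    qed
    ultimately show False using count by simp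
  qed
qed

text \<open>A disk reached by the descent. The last two conjuncts integrate the slopes of \<open>G\<close> and \<open>F\<close> from
  radius \<open>r\<close> down to \<open>s\<close>.\<close>

definition good :: "'k \<Rightarrow> real \<Rightarrow> bool" where
  "good b s \<longleftrightarrow> s > 0 \<and> (poly p b = 0 \<or> poly q b = 0) \<and> F b s > r \<and>
     num_roots p (odisk b s) + num_roots q (odisk b s) \<le> num_roots W (odisk b s) \<and>
     G b s \<le> s / r \<and> (r / L) * (s / r) ^ d \<le> F b s"

text \<open>At \<open>\<zeta>(a,r)\<close> we have \<open>F = r / L\<close> and
  \<open>G = 1\<close>. The closed disk contains all \<open>2 * d - 1\<close> roots of
  \<open>p\<close> and \<open>q\<close> and all \<open>2 * d - 2\<close> roots of \<open>W\<close>,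
  a deficit of one, and \<open>a\<close> and a root at distance \<open>r\<close> from it lie in
  different classes, so \<open>split_closed_disk\<close> applies.\<close>

lemma good_exists: "\<exists>b s. good b s"
proof -
  have all: "x \<in> cdisk a r" if "poly p x = 0 \<or> poly q x = 0" for x
    using r(2)[OF that] by (simp add: cdisk_def)
  have sz: "gauss_norm g a r = v (lead_coeff g) * r ^ degree g" if "\<And>x. poly g x = 0 \<Longrightarrow> x \<in> cdisk a r" "g \<noteq> 0" for g
  proof -
    have "(\<Prod>\<rho>\<in>#B. max r (v (\<rho> - a))) = r ^ size B" if "\<And>x. x \<in># B \<Longrightarrow> v (x - a) \<le> r" for B
      using that by (induction B) (simp_all add: max_absorb1)
    from this[of "proots g"] show ?thesis using that by (simp add: gauss_norm_def cdisk_def)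
  qed
  have pw: "t ^ d = t * t ^ degree q" for t :: real
    unfolding deg(2)[symmetric] by simp
  have Far: "F a r = r / L"
    using all r(1) by (simp add: F_def sz L deg(1) pw)
  have Fr: "F a r > r" using Far L L_pos r(1) by (simp add: field_simps)
  \<comment> \<open>Beyond radius \<open>r\<close> there are no roots of \<open>p\<close> and
    \<open>q\<close>, and \<open>F a t = t / L > r\<close> there.\<close>
  have Wall: "x \<in> cdisk a r" if "poly W x = 0" for x
  proof (rule ccontr)
    assume "x \<notin> cdisk a r"
    then have x: "v (x - a) > r" by (simp add: cdisk_def)
    let ?t = "v (x - a)"
    have t: "?t > 0" using x r(1) by linarith
    have sz': "gauss_norm g a ?t = v (lead_coeff g) * ?t ^ degree g" if "\<And>x. poly g x = 0 \<Longrightarrow> x \<in> cdisk a r" "g \<noteq> 0" for g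
    proof -
      have "(\<Prod>\<rho>\<in>#B. max ?t (v (\<rho> - a))) = ?t ^ size B" if "\<And>x. x \<in># B \<Longrightarrow> v (x - a) \<le> r" for B
        using that
      proof (induction B)
        case (add y B)
        then have "v (y - a) \<le> ?t" using x by fastforce
        then show ?case using add by (simp add: max_absorb1)
      qed simp
      from this[of "proots g"] show ?thesis using that by (simp add: gauss_norm_def cdisk_def)
    qed
    have "F a ?t = ?t / L"
      using all t by (simp add: F_def sz' L deg(1) pw)
    moreover have "?t / L > r"
    proof -
      have "?t * L < ?t * 1" using L t by (intro mult_strict_left_mono) auto
      then have "?t < ?t / L" using L_pos by (simp add: field_simps)
      then show ?thesis using x by linarith
    qed
    ultimately have "poly W x \<noteq> 0"
    proof (intro W_nonzero_annulus[of r x a "?t + 1"])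
      show "poly p y \<noteq> 0 \<and> poly q y \<noteq> 0" if "r < v (y - a)" for y
        using r(2)[of y] that by force
    qed (use t x in auto)
    then show False using that by simp
  qed
  have GA: "G a r = 1"
  proof -
    have e: "2 * d - 2 = degree q + degree q" using deg by linarith
    have "gauss_norm W a r = v (lead_coeff p) * v (lead_coeff q) * (r ^ degree q * r ^ degree q)"
      using sz[OF Wall W_deg(3)] unfolding W_deg(2) unfolding W_deg(1) e by (simp add: mult power_add)
    moreover have "v (lead_coeff q) \<noteq> 0" "v (coeff p d) \<noteq> 0"
      unfolding deg(1)[symmetric] by (simp_all add: eq_0_iff)
    ultimately show ?thesis
      using all r(1) by (simp add: G_def sz deg(1) pw)
  qed
  have nums: "num_roots p (cdisk a r) = d" "num_roots q (cdisk a r) = d - 1" "num_roots W (cdisk a r) = 2 * d - 2"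
    using num_roots_all[of p "cdisk a r"] num_roots_all[of q "cdisk a r"] num_roots_all[of W "cdisk a r"]
      all Wall deg W_deg by auto
  obtain x where x: "poly p x = 0 \<or> poly q x = 0" "v (x - a) = r" using r(3) by blast
  obtain z where z: "poly p z = 0 \<or> poly q z = 0" "v (z - a) \<le> r"
    "num_roots p (odisk z r) + num_roots q (odisk z r) \<le> num_roots W (odisk z r)"
  proof (rule split_closed_disk[OF r(1) Fr, of x a])
    show "num_roots p (cdisk a r) + num_roots q (cdisk a r) \<le> num_roots W (cdisk a r) + 1"
      using nums deg by simp
  qed (use x a r(1) in auto)
  then have "good z r"
    using Fr Far GA r(1) L_pos FG_recentre[of z a r] by (simp add: good_def)
  then show ?thesis by blast
qed

text \<open>Shrink the radius from \<open>s\<close> to the distance \<open>s1\<close> from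
  \<open>b\<close> of the farthest root of \<open>p\<close> or \<open>q\<close> inside. If
  \<open>F\<close> reaches \<open>r\<close> on the way, or if \<open>s1 = 0\<close>, there is a
  contradiction; otherwise the closed disk of radius \<open>s1\<close> splits into classes, one of
  which is good.\<close>

lemma good_step:
  assumes "good b s"
  shows "\<exists>b' s'. good b' s' \<and> num_roots (p * q) (odisk b' s') < num_roots (p * q) (odisk b s)"
proof -
  note gd = assms[unfolded good_def]
  have s: "s > 0" using gd by simp
  define R where "R = {x. (poly p x = 0 \<or> poly q x = 0) \<and> v (x - b) < s}"
  have "finite R"
    using nz[THEN poly_roots_finite] by (auto simp: R_def intro: finite_subset[of _ "{z. poly p z = 0} \<union> {z. poly q z = 0}"])
  moreover have bR: "b \<in> R" using gd by (simp add: R_def)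
  moreover define s1 where "s1 = Max ((\<lambda>x. v (x - b)) ` R)"
  ultimately have "s1 \<in> (\<lambda>x. v (x - b)) ` R" and s1max: "\<And>x. x \<in> R \<Longrightarrow> v (x - b) \<le> s1"
    by (auto simp: s1_def intro!: Max_in)
  then obtain x1 where x1: "x1 \<in> R" "v (x1 - b) = s1" by auto
  have s1: "0 \<le> s1" "s1 < s" using x1 nonneg by (auto simp: R_def)
  have ann: "poly p y \<noteq> 0 \<and> poly q y \<noteq> 0" if "s1 < v (y - b)" "v (y - b) < s" for y
    using s1max[of y] that by (auto simp: R_def)
  \<comment> \<open>In logarithmic scale these are the slopes of the three Gauss norms between
    \<open>s1\<close> and \<open>s\<close>; for \<open>W\<close> this holds as long as
    \<open>F > r\<close>, which excludes roots of \<open>W\<close> in between.\<close>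
  define kp kq kW where "kp = num_roots p (odisk b s)" and "kq = num_roots q (odisk b s)"
    and "kW = num_roots W (odisk b s)"
  have scale: "gauss_norm p b t = gauss_norm p b s * (t / s) ^ kp" "gauss_norm q b t = gauss_norm q b s * (t / s) ^ kq"
    if "s1 \<le> t" "t \<le> s" "0 < t" for t
    unfolding kp_def kq_def using that ann by (auto intro!: gauss_norm_scale) (meson le_less_linear le_less_trans)+
  have F_scale: "F b t = F b s * ((t / s) ^ kp / (t / s) ^ kq)" if "s1 \<le> t" "t \<le> s" "0 < t" for t
    by (simp add: F_def scale[OF that])
  \<comment> \<open>The slope of \<open>G\<close> is \<open>1 + kW - kp - kq\<close>, which is at
    least 1 because the disk is good.\<close>
  have G_scale: "G b t \<le> t / r"
    if "s1 \<le> t" "t \<le> s" "0 < t" "\<And>u. t < u \<Longrightarrow> u < s \<Longrightarrow> F b u > r" for t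
  proof -
    have "gauss_norm W b t = gauss_norm W b s * (t / s) ^ kW"
      unfolding kW_def
    proof (rule gauss_norm_scale)
      fix x assume "poly W x = 0"
      then show "v (x - b) \<le> t \<or> s \<le> v (x - b)"
        using W_nonzero_annulus[of s1 x b s] ann that by (smt (verit, best))
    qed (use that in \<open>auto simp: W_deg\<close>)
    then have "G b t = G b s * ((t / s) * (t / s) ^ kW / ((t / s) ^ kp * (t / s) ^ kq))"
      using s by (simp add: G_def scale[OF that(1-3)] mult_ac)
    also have "\<dots> \<le> (s / r) * (t / s)"
    proof (rule mult_mono)
      have "(t / s) ^ kW \<le> (t / s) ^ (kp + kq)"
        using that s gd by (intro power_decreasing) (auto simp: kp_def kq_def kW_def)
      then show "(t / s) * (t / s) ^ kW / ((t / s) ^ kp * (t / s) ^ kq) \<le> t / s"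
        using that s by (simp add: power_add divide_le_eq)
    qed (use gd that r(1) in auto)
    also have "\<dots> = t / r" using s by simp
    finally show ?thesis .
  qed
  \<comment> \<open>The slope of \<open>F\<close> is \<open>kp - kq\<close>, hence at most
    \<open>kp \<le> d\<close>.\<close>
  have F_lower: "(r / L) * (t / r) ^ d \<le> F b t" if "s1 \<le> t" "t \<le> s" "0 < t" for t
  proof -
    have "(r / L) * (t / r) ^ d = (r / L) * (s / r) ^ d * (t / s) ^ d"
      using s by (simp add: power_divide)
    also have "\<dots> \<le> F b s * (t / s) ^ d"
      using gd that by (intro mult_right_mono) auto
    also have "\<dots> \<le> F b s * (t / s) ^ kp"
      using that s F_pos[of s b] num_roots_le_degree[of p "odisk b s"] deg
      by (intro mult_left_mono power_decreasing) (auto simp: kp_def)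
    also have "\<dots> \<le> F b t"
    proof -
      have "(t / s) ^ kq \<le> 1" using that s by (intro power_le_one) auto
      then show ?thesis
        unfolding F_scale[OF that] using that s F_pos[of s b]
        by (intro mult_left_mono) (auto simp: field_simps)
    qed
    finally show ?thesis .
  qed
  show ?thesis
  proof (cases "\<exists>t. s1 \<le> t \<and> t < s \<and> 0 < t \<and> F b t \<le> r")
    case True
    then obtain t where t: "s1 \<le> t" "t < s" "0 < t" "F b t \<le> r" by blast
    define y where "y = t / s"
    have y: "0 < y" "y < 1" using t s by (auto simp: y_def)
    have "kp > kq"
    proof (rule ccontr)
      assume "\<not> kq < kp"
      then have "(t / s) ^ kq \<le> (t / s) ^ kp" using t by (intro power_decreasing) auto
      then have "F b s * 1 \<le> F b t"
        using t F_pos[OF s, of b] s by (subst F_scale) (auto intro!: mult_left_mono simp: field_simps)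
      then show False using t gd by simp
    qed
    define m where "m = kp - kq"
    have m: "m > 0" "kp = kq + m" using \<open>kp > kq\<close> by (auto simp: m_def)
    have Fm: "F b u = F b s * (u / s) ^ m" if "s1 \<le> u" "u \<le> s" "0 < u" for u
      using F_scale[OF that] that s by (simp add: m power_add)
    \<comment> \<open>\<open>s' = s * x\<close> is the radius at which \<open>F\<close> equals
      \<open>r\<close>, because \<open>F b u = F b s * (u / s) ^ m\<close> from \<open>s1\<close> to
      \<open>s\<close>.\<close>
    define x where "x = root m (r / F b s)"
    have xm: "x ^ m = r / F b s" using m r(1) F_pos[OF s] by (simp add: x_def less_imp_le)
    have x: "0 < x" "x < 1"
      using m r(1) F_pos[OF s] gd by (auto simp: x_def)
    define s' where "s' = s * x"
    have "(t / s) ^ m = F b t / F b s"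
      using Fm[of t] t F_pos[OF s, of b] by simp
    then have "(t / s) ^ m \<le> x ^ m"
      using t(4) F_pos[OF s, of b] by (simp add: xm divide_right_mono)
    then have "t / s \<le> x" using x t s by (subst (asm) power_mono_iff) (use m in auto)
    then have "t \<le> s'" using s by (simp add: s'_def field_simps)
    then have s': "s1 \<le> s'" "s' < s" "0 < s'" using t s x by (auto simp: s'_def)
    have Fs': "F b s' = r"
      using Fm[of s'] s' s xm F_pos[OF s, of b] by (simp add: s'_def)
    have Fgt: "F b u > r" if "s' < u" "u < s" for u
    proof -
      have "x < u / s" using that s by (simp add: s'_def field_simps)
      then have "x ^ m < (u / s) ^ m" using m x by (intro power_strict_mono) auto
      then have "r < (u / s) ^ m * F b s" using F_pos[OF s, of b] by (simp add: xm pos_divide_less_eq)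
      then show ?thesis using Fm[of u] that s' by (simp add: mult.commute)
    qed
    have Lm: "L < v (of_nat m) ^ d"
    proof (rule slope[OF s'(3,2) m(1), of b])
      show "num_roots p (odisk b s) = num_roots q (odisk b s) + m" using m(2) by (simp add: kp_def kq_def)
    qed (use ann s' in auto)
    have "(r / L) * (s' / r) ^ d \<le> r" using F_lower[of s'] s' Fs' by simp
    then have "(s' / r) ^ d \<le> L" using r(1) L_pos by (simp add: field_simps)
    then have "(s' / r) ^ d < v (of_nat m) ^ d" using Lm by simp
    then have "s' / r < v (of_nat m)" using nonneg power_less_imp_less_base by blast
    then have "s' < min s (r * v (of_nat m))" using r(1) s'(2) by (simp add: field_simps)
    \<comment> \<open>\<open>s'\<close> need not be a value of \<open>v\<close>. A slightly larger
      circle serves as well, as long as \<open>v z / r\<close> stays below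
      \<open>v (of_nat m)\<close>.\<close>
    then obtain z where z: "s' < v z" "v z < min s (r * v (of_nat m))"
      using abs_dense[of s'] s'(3) by (metis less_imp_le)
    have "v (of_nat m) \<le> v z * gauss_norm (wronskian p q) b (v z) / (gauss_norm p b (v z) * gauss_norm q b (v z))"
    proof (rule abs_slope_le)
      show "z \<noteq> 0" using z s' by auto
      show "poly p x \<noteq> 0 \<and> poly q x \<noteq> 0" if "v (x - b) = v z" for x using ann[of x] that z s' by auto
      have "num_roots g (odisk b (v z)) = num_roots g (odisk b s)" if "g = p \<or> g = q" for g
      proof (rule num_roots_cong)
        show "g \<noteq> 0" using that by auto
        fix x assume "poly g x = 0"
        then show "x \<in> odisk b (v z) \<longleftrightarrow> x \<in> odisk b s"
          using ann[of x] z s' that by (auto simp: odisk_def) (smt (verit, best))+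
      qed
      then show "num_roots p (odisk b (v z)) = num_roots q (odisk b (v z)) + m"
        using m(2) by (simp add: kp_def kq_def)
    qed auto
    also have "\<dots> = G b (v z)" by (simp add: G_def W_def)
    also have "\<dots> \<le> v z / r"
      using z s' Fgt by (intro G_scale) auto
    also have "\<dots> < v (of_nat m)" using z r(1) by (simp add: field_simps)
    finally show ?thesis by simp
  next
    case False
    then have Fgt: "F b t > r" if "s1 \<le> t" "t < s" "0 < t" for t using that by force
    have W_in: "v (x - b) \<le> s1" if "poly W x = 0" "v (x - b) < s" for x
    proof (rule ccontr)
      assume "\<not> v (x - b) \<le> s1"
      then have x: "s1 < v (x - b)" "0 < v (x - b)" using s1 by linarith+
      then show False
        using W_nonzero_annulus[OF x(1) that(2) x(2) Fgt ann] that by simp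
    qed
    have cd_od: "num_roots g (cdisk b s1) = num_roots g (odisk b s)"
      if "g = p \<or> g = q \<or> g = W" for g
    proof (rule num_roots_cong)
      show "g \<noteq> 0" using that by (auto simp: W_deg)
      fix x assume "poly g x = 0"
      then show "x \<in> cdisk b s1 \<longleftrightarrow> x \<in> odisk b s"
        using that W_in[of x] s1max[of x] s1 by (auto simp: odisk_def cdisk_def R_def)
    qed
    show ?thesis
    proof (cases "s1 = 0")
      \<comment> \<open>Here \<open>b\<close> is the only possible root of \<open>p\<close>,
        \<open>q\<close> or \<open>W\<close> in the disk, so the root counts are orders at
        \<open>b\<close>.\<close>
      case True
      have only: "x = b" if "poly g x = 0" "x \<in> odisk b s" "g = p \<or> g = q \<or> g = W" for x g
        using that W_in[of x] s1max[of x] nonneg[of "x - b"] True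
        by (auto simp: odisk_def R_def eq_0_iff)
      have ord: "num_roots g (odisk b s) = order b g" if "g = p \<or> g = q \<or> g = W" for g
      proof (cases "poly g b = 0")
        case True
        have "g \<noteq> 0" using that by (auto simp: W_deg)
        moreover have "{x. poly g x = 0 \<and> x \<in> odisk b s} = {b}"
          using only[OF _ _ that] True s by (auto simp: odisk_def)
        ultimately show ?thesis by (simp add: num_roots_sum)
      next
        case False
        have "g \<noteq> 0" using that by (auto simp: W_deg)
        moreover have "{x. poly g x = 0 \<and> x \<in> odisk b s} = {}"
          using only[OF _ _ that] False by auto
        ultimately show ?thesis using False by (simp add: num_roots_sum order_0I del: Collect_empty_eq)
      qed
      show ?thesis
      proof (cases "poly q b = 0")
        case True
        \<comment> \<open>At a pole the order of \<open>W\<close> is too small for the count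
          \<open>kp + kq \<le> kW\<close>.\<close>
        have "kW < kq" using order_W_pole[OF True] ord by (simp add: kW_def kq_def)
        then show ?thesis using gd by (simp add: kW_def kq_def)
      next
        case False
        then have "poly p b = 0" using gd by simp
        then have kp: "kp \<ge> 1" and kq: "kq = 0" using ord False order_root[of p b]
          by (auto simp: kp_def kq_def order_0I Suc_le_eq)
        \<comment> \<open>At a zero of \<open>p\<close> the size \<open>F\<close> decreases at least
          linearly in the radius, so it has fallen to \<open>r\<close> at this
          \<open>t\<close>.\<close>
        define t where "t = s * (r / F b s)"
        have rF: "0 < r / F b s" "r / F b s < 1" using r(1) gd F_pos[OF s, of b] by (auto simp: field_simps)
        have t: "0 < t" "t < s"
          using mult_pos_pos[OF s rF(1)] mult_strict_left_mono[OF rF(2) s] by (simp_all add: t_def)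
        have "F b t = F b s * (t / s) ^ kp" using F_scale[of t] t True kq by simp
        also have "\<dots> \<le> F b s * (t / s) ^ 1"
          using kp t F_pos[OF s, of b] by (intro mult_left_mono power_decreasing) auto
        also have "\<dots> = r" using s F_pos[OF s, of b] by (simp add: t_def)
        finally show ?thesis using Fgt[of t] t True by simp
      qed
    next
      case False
      then have s1p: "s1 > 0" using s1 by simp
      have Fs1: "F b s1 > r" using Fgt s1 s1p by simp
      obtain z where z: "poly p z = 0 \<or> poly q z = 0" "v (z - b) \<le> s1"
        "num_roots p (odisk z s1) + num_roots q (odisk z s1) \<le> num_roots W (odisk z s1)"
      proof (rule split_closed_disk[OF s1p Fs1, of x1 b])
        show "num_roots p (cdisk b s1) + num_roots q (cdisk b s1) \<le> num_roots W (cdisk b s1) + 1"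
          using cd_od gd by simp
      qed (use x1 gd s1p in \<open>auto simp: R_def\<close>)
      have "good z s1"
        using z s1 s1p Fs1 FG_recentre[of z b s1] G_scale[of s1] F_lower[of s1] Fgt
        by (simp add: good_def)
      moreover have "num_roots (p * q) (odisk z s1) < num_roots (p * q) (odisk b s)"
      proof -
        have sub: "odisk z s1 \<subseteq> odisk b s"
        proof
          fix w assume "w \<in> odisk z s1"
          then show "w \<in> odisk b s" using z(2) s1 abs_triangle[of w b z] by (simp add: odisk_def)
        qed
        \<comment> \<open>\<open>b\<close> and \<open>x1\<close> have distance \<open>s1\<close>, so
          the chosen class misses at least one of them; this makes the number of roots drop.\<close>
        obtain w where w: "w = b \<or> w = x1" "w \<notin> odisk z s1"
        proof (cases "b \<in> odisk z s1")
          case True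
          have "x1 \<notin> odisk b s1" using x1 by (simp add: odisk_def)
          then have "x1 \<notin> odisk z s1" using odisk_recentre[OF True] by simp
          then show ?thesis using that by blast
        qed (use that in blast)
        show ?thesis
          by (rule num_roots_less[OF _ sub _ _ w(2)]) (use w(1) gd x1 in \<open>auto simp: odisk_def R_def\<close>)
      qed
      ultimately show ?thesis by blast
    qed
  qed
qed

text \<open>Descent on the number of roots of \<open>p * q\<close> in a good disk.\<close>

lemma no_crit_False: False
proof -
  have "\<not> good b s" for b s
  proof (induction "num_roots (p * q) (odisk b s)" arbitrary: b s rule: less_induct)
    case less
    then show ?case using good_step by blast
  qed
  then show False using good_exists by blast
qed

end

theorem critical_value_exists:
  "\<exists>x. poly W x = 0 \<and> poly q x \<noteq> 0 \<and> v (poly p x / poly q x) > r"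
proof (rule ccontr)
  assume "\<not> ?thesis"
  then have "v (poly p x) \<le> r * v (poly q x)" if "poly W x = 0" "poly q x \<noteq> 0" for x
    using that by (force simp: abs_divide not_less divide_le_eq)
  then show False using no_crit_False by blast
qed

end

section \<open>Directional degrees and the change of coordinate\<close>

lemma num_roots_Un:
  assumes "S \<inter> T = {}"
  shows "num_roots g (S \<union> T) = num_roots g S + num_roots g T"
proof -
  have "size {#x \<in># A. x \<in> S \<union> T#} = size {#x \<in># A. x \<in> S#} + size {#x \<in># A. x \<in> T#}" for A
    using assms by (induction A) auto
  then show ?thesis by (simp add: num_roots_def)
qed

lemma order_ge_2:
  fixes h :: "'k::field poly"
  assumes "h \<noteq> 0" "poly h x = 0" "poly (pderiv h) x = 0"
  shows "order x h \<ge> 2"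
proof -
  obtain g where g: "h = [:-x, 1:] * g" using assms(2) by (auto simp: poly_eq_0_iff_dvd)
  have "pderiv h = [:-x, 1:] * pderiv g + g" unfolding g pderiv_mult by (simp add: pderiv_pCons)
  then have "poly g x = 0" using assms(3) by simp
  then have "[:-x, 1:] ^ 2 dvd h" unfolding g power2_eq_square
    by (intro mult_dvd_mono) (simp_all only: poly_eq_0_iff_dvd dvd_refl)
  then show ?thesis using assms(1) by (simp only: order_divides) auto
qed

lemma Fin_in_image [simp]: "Fin x \<in> Fin ` S \<longleftrightarrow> x \<in> S" "Infty \<notin> Fin ` S"
  by auto

section \<open>Images of annuli under a rational function\<close>

context alg_closed_nonarch_abs
begin

definition annulus :: "'k \<Rightarrow> real \<Rightarrow> real \<Rightarrow> 'k set" where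
  "annulus b s t = {x. s < v (x - b) \<and> v (x - b) < t}"

text \<open>On the annulus \<open>v (p / q) = C * v (x - b) ^ m\<close>. For a value
  \<open>y\<close>, the polynomial \<open>y * q\<close> dominates \<open>p\<close> just inside the
  circle where \<open>v (p / q) = v y\<close>, and \<open>p\<close> dominates just outside, so
  \<open>p - y * q\<close> has \<open>m\<close> roots on that circle. A single \<open>C\<close>
  serves all outer radii \<open>t\<close>.\<close>

lemma annulus_map_count:
  assumes nz: "p \<noteq> 0" "q \<noteq> 0" and s: "0 < s" "s < e" and m: "0 < m"
    and ann: "\<And>x. x \<in> annulus b s e \<Longrightarrow> poly p x \<noteq> 0 \<and> poly q x \<noteq> 0"
    and count: "num_roots p (odisk b e) = num_roots q (odisk b e) + m"
  obtains C where "C > 0"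
    "\<And>t. s < t \<Longrightarrow> t \<le> e \<Longrightarrow> (\<lambda>x. poly p x / poly q x) ` annulus b s t = annulus 0 (C * s ^ m) (C * t ^ m)"
    "\<And>t y. s < t \<Longrightarrow> t \<le> e \<Longrightarrow> y \<in> annulus 0 (C * s ^ m) (C * t ^ m) \<Longrightarrow>
      (\<Sum>x | x \<in> annulus b s t \<and> poly p x / poly q x = y. order x (p - smult y q)) = m"
proof -
  define C where "C = gauss_norm p b e / gauss_norm q b e / e ^ m"
  have gp: "t > 0 \<Longrightarrow> gauss_norm p b t > 0" "t > 0 \<Longrightarrow> gauss_norm q b t > 0" for t using nz gauss_norm_pos by auto
  have C: "C > 0" using s gp[of e] by (simp add: C_def)
  have gnt: "gauss_norm p b t = C * t ^ m * gauss_norm q b t" if "s < t" "t < e" for t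
  proof -
    have "v (x - b) \<le> t \<or> e \<le> v (x - b)" if "poly p x = 0 \<or> poly q x = 0" for x
      using ann[of x] that \<open>s < t\<close> by (force simp: annulus_def)
    then have "gauss_norm p b t = gauss_norm p b e * (t / e) ^ num_roots p (odisk b e)"
      "gauss_norm q b t = gauss_norm q b e * (t / e) ^ num_roots q (odisk b e)"
      using that s nz by (auto intro!: gauss_norm_scale)
    then show ?thesis using s gp(2)[of e]
      by (simp add: count C_def power_add power_divide) (simp add: field_simps)
  qed
  have val: "v (poly p x / poly q x) = C * v (x - b) ^ m" if "x \<in> annulus b s e" for x
  proof -
    let ?t = "v (x - b)"
    have t: "s < ?t" "?t < e" using that by (auto simp: annulus_def)
    have no_roots: "poly p y \<noteq> 0 \<and> poly q y \<noteq> 0" if "y \<in> odisk x ?t" for y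
    proof -
      have "v (y - b) = ?t" using that abs_add_eq[of "y - x" "x - b"] by (simp add: odisk_def)
      then show ?thesis using t by (intro ann) (simp add: annulus_def)
    qed
    have "v (poly p x) = gauss_norm p b ?t" "v (poly q x) = gauss_norm q b ?t"
      using no_roots nz by (auto intro!: abs_poly_eq_gauss_norm)
    then show ?thesis using gnt[OF t] gp(2)[of ?t] t s
      by (smt (verit) abs_divide nonzero_mult_div_cancel_right)
  qed
  have sum: "(\<Sum>x | x \<in> annulus b s t \<and> poly p x / poly q x = y. order x (p - smult y q)) = m"
    if t: "s < t" "t \<le> e" and y: "y \<in> annulus 0 (C * s ^ m) (C * t ^ m)" for t y
  proof -
    define h where "h = p - smult y q"
    \<comment> \<open>The radius of the circle that contains all solutions; \<open>t1\<close> and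
      \<open>t2\<close> lie on either side of it.\<close>
    define t0 where "t0 = root m (v y / C)"
    have yv: "C * s ^ m < v y" "v y < C * t ^ m" using y by (auto simp: annulus_def)
    have yC: "v y / C \<ge> 0" using C nonneg[of y] by simp
    have t0m: "t0 ^ m = v y / C" using yC m by (simp add: t0_def)
    have t00: "t0 \<ge> 0" using yC m by (simp add: t0_def)
    have st0: "s < t0" "t0 < t"
    proof -
      have "s ^ m < t0 ^ m" "t0 ^ m < t ^ m" using yv C by (simp_all add: t0m field_simps)
      then show "s < t0" "t0 < t" using t00 t s by (auto intro: power_less_imp_less_base)
    qed
    define t1 t2 where "t1 = (s + t0) / 2" and "t2 = (t0 + t) / 2"
    have t12: "s < t1" "t1 < t0" "t0 < t2" "t2 < t" using st0 by (auto simp: t1_def t2_def)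
    have pow: "C * t1 ^ m < v y" "v y < C * t2 ^ m"
    proof -
      have "t1 ^ m < t0 ^ m" "t0 ^ m < t2 ^ m" using t12 s m by (auto intro!: power_strict_mono)
      then show "C * t1 ^ m < v y" "v y < C * t2 ^ m" using C by (simp_all add: t0m field_simps)
    qed
    have y0: "y \<noteq> 0" using yv C s by (metis abs_0 less_trans mult_pos_pos zero_less_power less_irrefl)
    have gny: "gauss_norm (smult (- y) q) b t' = v y * gauss_norm q b t'" for t'
      using y0 by (simp add: gauss_norm_def mult del: smult_minus_left)
    have d1: "gauss_norm p b t1 < gauss_norm (smult (- y) q) b t1"
      using gnt[of t1] pow gp(2)[of t1] t12 t s by (simp add: gny del: smult_minus_left)
    have d2: "gauss_norm (smult (- y) q) b t2 < gauss_norm p b t2"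
      using gnt[of t2] pow gp(2)[of t2] t12 t s by (simp add: gny del: smult_minus_left)
    have h0: "h \<noteq> 0"
    proof
      assume "h = 0"
      then have "p = smult y q" by (simp add: h_def)
      then have "gauss_norm p b t1 = v y * gauss_norm q b t1" using y0 by (simp add: gauss_norm_def mult)
      then show False using d1 gny[of t1] by (simp del: smult_minus_left)
    qed
    have "num_roots h (odisk b t1) = num_roots (smult (- y) q) (odisk b t1)"
      using num_roots_dominated[OF _ d1] h0 nz y0 t12 s by (simp add: h_def)
    also have "\<dots> = num_roots q (odisk b t1)"
      using y0 by (simp add: num_roots_def del: smult_minus_left)
    also have "\<dots> = num_roots q (odisk b e)"
      using ann t12 t nz by (intro num_roots_cong) (auto simp: annulus_def odisk_def, force)
    finally have n1: "num_roots h (odisk b t1) = num_roots q (odisk b e)" .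
    have "num_roots h (odisk b t2) = num_roots p (odisk b t2)"
      using num_roots_dominated[OF _ d2] h0 nz y0 t12 s by (simp add: h_def)
    also have "\<dots> = num_roots p (odisk b e)"
      using ann t12 t nz by (intro num_roots_cong) (auto simp: annulus_def odisk_def, force)
    finally have n2: "num_roots h (odisk b t2) = num_roots p (odisk b e)" .
    have eqv: "poly p x / poly q x = y \<longleftrightarrow> poly h x = 0" if "x \<in> annulus b s t" for x
      using ann[of x] that t by (auto simp: annulus_def h_def field_simps)
    have root: "v (x - b) = t0" if "x \<in> annulus b s t" "poly h x = 0" for x
    proof -
      have "C * v (x - b) ^ m = v y"
        using val[of x] that eqv[of x] t by (auto simp: annulus_def)
      then have "v (x - b) ^ m = t0 ^ m" using C by (simp add: t0m field_simps)
      then show ?thesis using power_eq_imp_eq_base t00 nonneg m by blast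
    qed
    have "num_roots h (odisk b t2) = num_roots h (odisk b t1 \<union> (odisk b t2 - odisk b t1))"
      using t12 by (intro arg_cong[of _ _ "num_roots h"]) (auto simp: odisk_def)
    also have "\<dots> = num_roots h (odisk b t1) + num_roots h (odisk b t2 - odisk b t1)"
      by (rule num_roots_Un) auto
    also have "num_roots h (odisk b t2 - odisk b t1) = num_roots h (annulus b s t)"
    proof (rule num_roots_cong[OF h0])
      fix x assume "poly h x = 0"
      then show "x \<in> odisk b t2 - odisk b t1 \<longleftrightarrow> x \<in> annulus b s t"
        using root[of x] t12 by (auto simp: odisk_def annulus_def)
    qed
    finally have "num_roots h (annulus b s t) = m" using n1 n2 count by simp
    moreover have "{x. x \<in> annulus b s t \<and> poly p x / poly q x = y} = {x. poly h x = 0 \<and> x \<in> annulus b s t}"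
      using eqv by auto
    ultimately show ?thesis using num_roots_sum[OF h0, of "annulus b s t"] by (simp add: h_def)
  qed
  have img: "(\<lambda>x. poly p x / poly q x) ` annulus b s t = annulus 0 (C * s ^ m) (C * t ^ m)"
    if t: "s < t" "t \<le> e" for t
  proof (intro equalityI subsetI)
    fix y assume "y \<in> (\<lambda>x. poly p x / poly q x) ` annulus b s t"
    then obtain x where x: "x \<in> annulus b s t" "y = poly p x / poly q x" by blast
    then have "s ^ m < v (x - b) ^ m" "v (x - b) ^ m < t ^ m"
      using s m by (auto simp: annulus_def nonneg intro!: power_strict_mono)
    then show "y \<in> annulus 0 (C * s ^ m) (C * t ^ m)"
      using val[of x] x t C by (simp add: annulus_def)
  next
    fix y assume y: "y \<in> annulus 0 (C * s ^ m) (C * t ^ m)"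
    have "{x. x \<in> annulus b s t \<and> poly p x / poly q x = y} \<noteq> {}"
    proof
      assume e: "{x. x \<in> annulus b s t \<and> poly p x / poly q x = y} = {}"
      show False using sum[OF t y] m unfolding e by simp
    qed
    then show "y \<in> (\<lambda>x. poly p x / poly q x) ` annulus b s t" by blast
  qed
  show ?thesis using that[OF C img sum] by blast
qed

text \<open>Density of the values of \<open>v\<close> gives nonemptiness.\<close>

lemma is_open_annulus_Fin:
  assumes "0 < s" "s < t"
  shows "is_open_annulus v (Fin ` annulus b s t)"
proof -
  obtain x where "s < v x" "v x < t" using abs_dense[of s t] assms by auto
  then have "x + b \<in> annulus b s t" by (simp add: annulus_def)
  then have "Fin ` annulus b s t \<noteq> {}" by blast
  moreover have "is_closed_disk v (closed_disk v b s)" "is_closed_disk v (- open_disk v b t)"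
    unfolding is_closed_disk_def using assms order.strict_trans[OF assms] by blast+
  moreover have "closed_disk v b s \<inter> - open_disk v b t = {}"
    using assms by (auto simp: closed_disk_def open_disk_def)
  moreover have "Fin ` annulus b s t = - (closed_disk v b s \<union> - open_disk v b t)"
  proof (rule set_eqI)
    fix z show "z \<in> Fin ` annulus b s t \<longleftrightarrow> z \<in> - (closed_disk v b s \<union> - open_disk v b t)"
      by (cases z) (auto simp: closed_disk_def open_disk_def annulus_def)
  qed
  ultimately show ?thesis unfolding is_open_annulus_def by blast
qed

end

section \<open>The map outside the disk of radius \<open>r\<close>\<close>

context attracting_infinity
begin

text \<open>All roots of \<open>p\<close> and \<open>q\<close> lie within \<open>r\<close> of
  \<open>a\<close>, so every factor \<open>x - \<rho>\<close> has absolute value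
  \<open>v (x - a)\<close>, and the degrees differ by one.\<close>

lemma outside:
  assumes "r < v (x - a)"
  shows "poly q x \<noteq> 0" "v (poly p x / poly q x) = v (x - a) / L"
proof -
  have *: "v (poly g x) = v (lead_coeff g) * v (x - a) ^ degree g"
    if "\<And>y. poly g y = 0 \<Longrightarrow> v (y - a) \<le> r" "g \<noteq> 0" for g
  proof -
    have "(\<Prod>\<rho>\<in>#B. v (x - \<rho>)) = v (x - a) ^ size B" if "\<And>y. y \<in># B \<Longrightarrow> v (y - a) \<le> r" for B
      using that
    proof (induction B)
      case (add y B)
      then have "v (a - y) < v (x - a)" using assms abs_minus_commute[of a y] by fastforce
      then have "v (x - y) = v (x - a)" using abs_add_eq'[of "a - y" "x - a"] by simp
      then show ?case using add by simp
    qed simp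
    from this[of "proots g"] show ?thesis using that
      by (subst poly_eq_prod_mset) (simp add: mult abs_prod_mset)
  qed
  show q0: "poly q x \<noteq> 0" using r(2)[of x] assms by auto
  have xa: "v (x - a) \<noteq> 0" using assms r(1) by linarith
  have "degree p = Suc (degree q)" using deg by simp
  then have "v (poly p x) = v (lead_coeff p) * (v (x - a) * v (x - a) ^ degree q)"
    using *[of p] r(2) by simp
  moreover have "v (poly q x) = v (lead_coeff q) * v (x - a) ^ degree q"
    using *[of q] r(2) by simp
  ultimately show "v (poly p x / poly q x) = v (x - a) / L"
    using xa by (simp add: abs_divide L)
qed

lemma outside_less: "r < v (x - a) \<Longrightarrow> r < v (poly p x / poly q x)"
proof -
  assume x: "r < v (x - a)"
  have "v (x - a) * L < v (x - a) * 1" using L x r(1) by (intro mult_strict_left_mono) auto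
  then have "v (x - a) < v (x - a) / L" using L_pos by (simp add: field_simps)
  then show ?thesis using x outside(2)[OF x] by linarith
qed

text \<open>With \<open>c\<close> the common value, \<open>c * q\<close> dominates \<open>p\<close>
  at a radius between \<open>r\<close> and \<open>v (x - a)\<close>. Hence \<open>d - 1\<close> of
  the \<open>d\<close> roots of \<open>p - c * q\<close> lie inside that radius, and only one is
  left for \<open>x\<close> and \<open>y\<close>.\<close>

lemma outside_inj:
  assumes "r < v (x - a)" "r < v (y - a)" "poly p x / poly q x = poly p y / poly q y"
  shows "x = y"
proof (rule ccontr)
  assume "x \<noteq> y"
  define c where "c = poly p x / poly q x"
  define h where "h = p - smult c q"
  have vc: "v c = v (x - a) / L" "v c = v (y - a) / L"
    using outside(2)[OF assms(1)] outside(2)[OF assms(2)] by (simp_all only: c_def assms(3))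
  then have xy: "v (x - a) = v (y - a)" using L_pos by simp
  have c0: "c \<noteq> 0" using vc L_pos assms(1) r(1) by auto
  have "degree (- smult c q) < degree p" using deg degree_smult_le[of c q] by simp
  then have dh: "degree h = d"
    unfolding h_def diff_conv_add_uminus using degree_add_eq_left[of "- smult c q" p] deg(1) by simp
  then have h0: "h \<noteq> 0" using deg by auto
  have hxy: "poly h x = 0" "poly h y = 0"
    using outside(1)[OF assms(1)] outside(1)[OF assms(2)] assms(3)
    by (simp_all add: h_def c_def nonzero_divide_eq_eq)
  define t where "t = (r + v (x - a)) / 2"
  have t: "r < t" "t < v (x - a)" "0 < t" using assms(1) r(1) by (auto simp: t_def)
  have norm_g: "gauss_norm g a t = v (lead_coeff g) * t ^ degree g"
    if "\<And>z. poly g z = 0 \<Longrightarrow> v (z - a) \<le> r" "g \<noteq> 0" for g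
  proof -
    have "(\<Prod>\<rho>\<in>#B. max t (v (\<rho> - a))) = t ^ size B" if "\<And>x. x \<in># B \<Longrightarrow> v (x - a) \<le> r" for B
      using that
    proof (induction B)
      case (add y B)
      then have "v (y - a) \<le> t" using t by fastforce
      then show ?case using add by (simp add: max_absorb1)
    qed simp
    from this[of "proots g"] show ?thesis using that by (simp add: gauss_norm_def)
  qed
  have pw: "t ^ d = t * t ^ degree q" unfolding deg(2)[symmetric] by simp
  have "gauss_norm p a t < gauss_norm (smult (- c) q) a t"
  proof -
    have "gauss_norm (smult (- c) q) a t = v c * gauss_norm q a t"
      using c0 by (simp add: gauss_norm_def mult del: smult_minus_left)
    also have "\<dots> = v (x - a) * (v (lead_coeff p) * t ^ degree q)"
      using vc(1) norm_g[of q] r(2) L by (simp add: eq_0_iff)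
    also have "\<dots> > t * (v (lead_coeff p) * t ^ degree q)"
      using t by (intro mult_strict_right_mono) auto
    finally show ?thesis using norm_g[of p] r(2) deg(1) pw by (simp add: mult_ac)
  qed
  then have "num_roots h (odisk a t) = num_roots (smult (- c) q) (odisk a t)"
    using num_roots_dominated[of t p a "smult (- c) q"] t h0 c0 by (simp add: h_def)
  also have "\<dots> = num_roots q (odisk a t)"
    using c0 by (simp add: num_roots_def del: smult_minus_left)
  also have "\<dots> = degree q"
    using r(2) t by (intro num_roots_all) (auto simp: odisk_def, fastforce)
  finally have 1: "num_roots h (odisk a t) = degree q" .
  have "num_roots h (odisk a t) + num_roots h {x, y} = num_roots h (odisk a t \<union> {x, y})"
    using xy t by (intro num_roots_Un[symmetric]) (auto simp: odisk_def)
  also have "\<dots> \<le> d" using num_roots_le_degree[of h] dh by metis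
  finally have "num_roots h {x, y} \<le> 1" using 1 deg by simp
  moreover have "num_roots h {x, y} = order x h + order y h"
  proof -
    have "{z. poly h z = 0 \<and> z \<in> {x, y}} = {x, y}" using hxy by auto
    then show ?thesis using num_roots_sum[OF h0, of "{x, y}"] \<open>x \<noteq> y\<close> by simp
  qed
  moreover have "order x h > 0" "order y h > 0" using hxy h0 by (simp_all add: order_gt_0_iff)
  ultimately show False by simp
qed

end

text \<open>\<open>P / Q\<close> is the map \<open>p / q\<close> in a coordinate in which the fixed point \<open>\<gamma>\<close> is \<open>\<infinity>\<close>,
  and \<open>M\<close> is the coordinate change.\<close>

locale normal_form = alg_closed_nonarch_abs v
  for v :: "'k::alg_closed_field \<Rightarrow> real" +
  fixes p q P Q :: "'k poly" and d :: nat and \<gamma> :: "'k proj_line" and M :: "'k proj_line \<Rightarrow> 'k proj_line"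
  assumes deg: "degree P = d" "Suc (degree Q) = d" "d \<ge> 2"
    and no_common_root: "\<And>x. poly P x = 0 \<Longrightarrow> poly Q x \<noteq> 0"
    and char: "\<And>m. 0 < m \<Longrightarrow> m \<le> d \<Longrightarrow> of_nat m \<noteq> (0 :: 'k)"
    and M: "inj M" "M Infty = \<gamma>"
    and fixed: "rat_map p q \<gamma> = \<gamma>"
    and rat_map_M: "\<And>w. poly Q w \<noteq> 0 \<Longrightarrow> rat_map p q (M (Fin w)) = M (Fin (poly P w / poly Q w))"
    and local_mult_M: "\<And>w. poly Q w \<noteq> 0 \<Longrightarrow>
      local_mult p q (M (Fin w)) = order w (P - smult (poly P w / poly Q w) Q)"
    and multiplier_M: "v (multiplier p q \<gamma>) = v (lead_coeff Q) / v (lead_coeff P)"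
    and direction_M: "\<And>b s. 0 < s \<Longrightarrow> \<exists>a r w. 0 < r \<and> is_direction v a r w \<and>
      (\<forall>e>0. \<exists>e'>0. \<forall>\<eta>. 0 < \<eta> \<and> \<eta> < e' \<longrightarrow>
        (\<exists>\<epsilon>. 0 < \<epsilon> \<and> \<epsilon> \<le> e \<and> dir_annulus v a r w \<eta> = M ` Fin ` annulus b s (s + \<epsilon>)))"
    and annulus_M: "\<And>b s. 0 < s \<Longrightarrow> \<exists>e>s. \<forall>t. s < t \<and> t < e \<longrightarrow> is_open_annulus v (M ` Fin ` annulus b s t)"
    and disk_M: "\<And>b s. 0 < s \<Longrightarrow> is_disk v (M ` insert Infty (Fin ` {x. s < v (x - b)}))"
    and chordal_M: "\<And>w. filterlim (\<lambda>n. v (w n)) at_top sequentially \<Longrightarrow>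
      (\<lambda>n. chordal v (M (Fin (w n))) \<gamma>) \<longlonglongrightarrow> 0"
    and dir_degree: "\<And>a r w. r > 0 \<Longrightarrow> is_direction v a r w \<Longrightarrow>
      v (multiplier p q \<gamma>) < v (of_nat (dir_degree v p q a r w)) ^ d"
begin

lemma nz [simp]: "P \<noteq> 0" "Q \<noteq> 0"
proof -
  show P: "P \<noteq> 0" using deg by auto
  have "degree P > 0" using deg by simp
  then obtain x where "poly P x = 0" using alg_closed_imp_poly_has_root by blast
  then show "Q \<noteq> 0" using no_common_root by auto
qed

lemma M_eq [simp]: "M x = M y \<longleftrightarrow> x = y" using M(1) by (rule inj_eq)

text \<open>This brings the hypothesis on \<open>dir_degree\<close> into the form used in the
  descent: by \<open>annulus_map_count\<close>, \<open>m\<close> is the degree in the direction that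
  corresponds under \<open>M\<close> to the upward one at \<open>\<zeta>(b,s)\<close>.\<close>

lemma multiplier_less:
  assumes s: "0 < s" "s < e" and m: "0 < m"
    and ann: "\<And>x. s < v (x - b) \<Longrightarrow> v (x - b) < e \<Longrightarrow> poly (P - smult a Q) x \<noteq> 0 \<and> poly Q x \<noteq> 0"
    and count: "num_roots (P - smult a Q) (odisk b e) = num_roots Q (odisk b e) + m"
  shows "v (multiplier p q \<gamma>) < v (of_nat m) ^ d"
proof -
  let ?p = "P - smult a Q"
  let ?f = "\<lambda>x. poly P x / poly Q x"
  have nzp: "?p \<noteq> 0"
  proof
    assume "?p = 0"
    then have "P = smult a Q" by simp
    then show False using deg degree_smult_le[of a Q] by simp
  qed
  have ann': "poly ?p x \<noteq> 0 \<and> poly Q x \<noteq> 0" if "x \<in> annulus b s e" for x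
    using ann[of x] that by (simp add: annulus_def)
  obtain C where C: "C > 0"
    and img: "\<And>t. s < t \<Longrightarrow> t \<le> e \<Longrightarrow>
      (\<lambda>x. poly ?p x / poly Q x) ` annulus b s t = annulus 0 (C * s ^ m) (C * t ^ m)"
    and sum: "\<And>t y. s < t \<Longrightarrow> t \<le> e \<Longrightarrow> y \<in> annulus 0 (C * s ^ m) (C * t ^ m) \<Longrightarrow>
      (\<Sum>x | x \<in> annulus b s t \<and> poly ?p x / poly Q x = y. order x (?p - smult y Q)) = m"
    by (rule annulus_map_count[OF nzp nz(2) s m ann' count]) auto
  have f: "?f x = poly ?p x / poly Q x + a" if "x \<in> annulus b s e" for x
    using ann'[OF that] by (simp add: field_simps)
  \<comment> \<open>Only thin annuli are sure to become annuli under \<open>M\<close>. The width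
    \<open>e3\<close> below makes the image annulus thin enough for this.\<close>
  obtain e1 where e1: "C * s ^ m < e1"
    "\<And>t. C * s ^ m < t \<Longrightarrow> t < e1 \<Longrightarrow> is_open_annulus v (M ` Fin ` annulus a (C * s ^ m) t)"
    using annulus_M[of "C * s ^ m" a] C s by (metis mult_pos_pos zero_less_power)
  have "((\<lambda>t. C * t ^ m) \<longlongrightarrow> C * s ^ m) (at_right s)"
    by (intro tendsto_intros)
  then have "\<forall>\<^sub>F t in at_right s. C * t ^ m < e1" using e1(1) by (rule order_tendstoD)
  then obtain e2 where e2: "s < e2" "\<And>t. s < t \<Longrightarrow> t < e2 \<Longrightarrow> C * t ^ m < e1"
    by (auto simp: eventually_at_right_field)
  define e3 where "e3 = (min e2 e - s) / 2"
  have e3: "0 < e3" "s + e3 < e2" "s + e3 \<le> e" using e2(1) s by (auto simp: e3_def min_def field_simps)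
  have onto: "maps_onto_annulus_m_to_1 v p q (M ` Fin ` annulus b s t) m" if t: "s < t" "t \<le> s + e3" for t
    unfolding maps_onto_annulus_m_to_1_def
  proof
    have te: "t \<le> e" using t e3 by simp
    have sub: "annulus b s t \<subseteq> annulus b s e" using te by (auto simp: annulus_def)
    have Q0: "poly Q x \<noteq> 0" if "x \<in> annulus b s t" for x using ann' that sub by blast
    have rm: "rat_map p q (M (Fin x)) = M (Fin (?f x))" if "x \<in> annulus b s t" for x
      using rat_map_M[OF Q0[OF that]] .
    have fA: "?f ` annulus b s t = annulus a (C * s ^ m) (C * t ^ m)"
    proof -
      have "?f ` annulus b s t = (\<lambda>y. y + a) ` (\<lambda>x. poly ?p x / poly Q x) ` annulus b s t"
        unfolding image_image by (rule image_cong) (use f sub in auto)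
      also have "\<dots> = (\<lambda>y. y + a) ` annulus 0 (C * s ^ m) (C * t ^ m)"
        by (simp only: img[OF t(1) te])
      also have "\<dots> = annulus a (C * s ^ m) (C * t ^ m)"
      proof (intro equalityI subsetI)
        fix y assume "y \<in> annulus a (C * s ^ m) (C * t ^ m)"
        then have "y - a \<in> annulus 0 (C * s ^ m) (C * t ^ m)" by (simp add: annulus_def)
        then show "y \<in> (\<lambda>y. y + a) ` annulus 0 (C * s ^ m) (C * t ^ m)"
          by (intro image_eqI[of _ _ "y - a"]) auto
      qed (auto simp: annulus_def)
      finally show ?thesis .
    qed
    have im: "rat_map p q ` M ` Fin ` annulus b s t = M ` Fin ` ?f ` annulus b s t"
      unfolding image_image by (rule image_cong) (use rm in auto)
    have "C * s ^ m < C * t ^ m" using C t s m by (simp add: power_strict_mono)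
    then show "is_open_annulus v (rat_map p q ` M ` Fin ` annulus b s t)"
      unfolding im fA using e1(2) e2(2)[of t] t e3 by simp
    show "\<forall>y\<in>rat_map p q ` M ` Fin ` annulus b s t.
      (\<Sum>x | x \<in> M ` Fin ` annulus b s t \<and> rat_map p q x = y. local_mult p q x) = m"
    proof
      fix y assume "y \<in> rat_map p q ` M ` Fin ` annulus b s t"
      then obtain z where z: "y = M (Fin z)" "z \<in> annulus a (C * s ^ m) (C * t ^ m)"
        unfolding im fA by blast
      have z': "z - a \<in> annulus 0 (C * s ^ m) (C * t ^ m)" using z(2) by (simp add: annulus_def)
      let ?S = "{x. x \<in> annulus b s t \<and> poly ?p x / poly Q x = z - a}"
      have set: "{x. x \<in> M ` Fin ` annulus b s t \<and> rat_map p q x = y} = (\<lambda>x. M (Fin x)) ` ?S"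
      proof -
        have "poly ?p x / poly Q x = z - a \<longleftrightarrow> rat_map p q (M (Fin x)) = y" if "x \<in> annulus b s t" for x
          using rm[OF that] f[of x] that sub z(1) by (auto simp: field_simps)
        then show ?thesis by auto
      qed
      have "(\<Sum>x | x \<in> M ` Fin ` annulus b s t \<and> rat_map p q x = y. local_mult p q x)
        = (\<Sum>x\<in>?S. local_mult p q (M (Fin x)))"
        unfolding set by (subst sum.reindex) (auto simp: inj_on_def)
      also have "\<dots> = (\<Sum>x\<in>?S. order x (?p - smult (z - a) Q))"
      proof (rule sum.cong)
        fix x assume x: "x \<in> ?S"
        then have "?f x = z" using f[of x] sub by auto
        \<comment> \<open>Subtracting \<open>a\<close> from both the map and the value leaves the
          fibre polynomial unchanged.\<close>
        then have "P - smult (?f x) Q = ?p - smult (z - a) Q" by (simp add: smult_diff_left)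
        then show "local_mult p q (M (Fin x)) = order x (?p - smult (z - a) Q)"
          using local_mult_M[OF Q0[of x]] x by (simp only: mem_Collect_eq)
      qed simp
      also have "\<dots> = m" by (rule sum[OF t(1) te z'])
      finally show "(\<Sum>x | x \<in> M ` Fin ` annulus b s t \<and> rat_map p q x = y. local_mult p q x) = m" .
    qed
  qed
  obtain a' r' w' where dir: "0 < r'" "is_direction v a' r' w'"
    and all: "\<forall>e>0. \<exists>e'>0. \<forall>\<eta>. 0 < \<eta> \<and> \<eta> < e' \<longrightarrow>
      (\<exists>\<epsilon>. 0 < \<epsilon> \<and> \<epsilon> \<le> e \<and> dir_annulus v a' r' w' \<eta> = M ` Fin ` annulus b s (s + \<epsilon>))"
    using direction_M[OF s(1), of b] by blast
  from all[rule_format, OF e3(1)] obtain e' where e': "e' > 0"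
    "\<And>\<eta>. 0 < \<eta> \<Longrightarrow> \<eta> < e' \<Longrightarrow> \<exists>\<epsilon>. 0 < \<epsilon> \<and> \<epsilon> \<le> e3 \<and> dir_annulus v a' r' w' \<eta> = M ` Fin ` annulus b s (s + \<epsilon>)"
    by blast
  have mo: "maps_onto_annulus_m_to_1 v p q (dir_annulus v a' r' w' \<eta>) m" if \<eta>: "0 < \<eta>" "\<eta> < e'" for \<eta>
  proof -
    obtain \<epsilon> where "0 < \<epsilon>" "\<epsilon> \<le> e3" "dir_annulus v a' r' w' \<eta> = M ` Fin ` annulus b s (s + \<epsilon>)"
      using e'(2)[OF \<eta>] by blast
    then show ?thesis using onto[of "s + \<epsilon>"] by simp
  qed
  have "dir_degree v p q a' r' w' = m"
    unfolding dir_degree_def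
  proof (rule the_equality)
    show "\<exists>\<epsilon>\<^sub>0>0. \<forall>\<epsilon>. 0 < \<epsilon> \<and> \<epsilon> < \<epsilon>\<^sub>0 \<longrightarrow>
        maps_onto_annulus_m_to_1 v p q (dir_annulus v a' r' w' \<epsilon>) m"
      using mo e'(1) by blast
  next
    \<comment> \<open>Two admissible degrees agree, because for small \<open>\<eta>\<close> both are
      the size of the same fibre over a point of the nonempty image.\<close>
    fix m' assume "\<exists>\<epsilon>\<^sub>0>0. \<forall>\<epsilon>. 0 < \<epsilon> \<and> \<epsilon> < \<epsilon>\<^sub>0 \<longrightarrow>
        maps_onto_annulus_m_to_1 v p q (dir_annulus v a' r' w' \<epsilon>) m'"
    then obtain e0 where e0: "e0 > 0" "\<And>\<epsilon>. 0 < \<epsilon> \<Longrightarrow> \<epsilon> < e0 \<Longrightarrow>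
      maps_onto_annulus_m_to_1 v p q (dir_annulus v a' r' w' \<epsilon>) m'" by blast
    define \<eta> where "\<eta> = min e0 e' / 2"
    have "0 < \<eta>" "\<eta> < e0" "\<eta> < e'" using e0(1) e'(1) by (auto simp: \<eta>_def)
    then have 1: "maps_onto_annulus_m_to_1 v p q (dir_annulus v a' r' w' \<eta>) m"
      "maps_onto_annulus_m_to_1 v p q (dir_annulus v a' r' w' \<eta>) m'"
      using mo e0 by auto
    then have "rat_map p q ` dir_annulus v a' r' w' \<eta> \<noteq> {}"
      by (simp add: maps_onto_annulus_m_to_1_def is_open_annulus_def)
    then show "m' = m" using 1 unfolding maps_onto_annulus_m_to_1_def by fastforce
  qed
  then show ?thesis using dir_degree[OF dir] by simp
qed

theorem critical_value_attracted:
  "\<exists>U. is_disk v U \<and> \<gamma> \<in> U \<and> rat_map p q ` U \<subseteq> U \<and> inj_on (rat_map p q) U \<and>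
     (\<forall>x\<in>U. attracted v p q \<gamma> x) \<and>
     (\<exists>y\<in>U. critical_value p q y \<and> strictly_attracted v p q \<gamma> y)"
proof -
  have "degree Q > 0" using deg by simp
  then obtain a where a: "poly Q a = 0" using alg_closed_imp_poly_has_root by blast
  define p1 where "p1 = P - smult a Q"
  have lt: "degree (smult a Q) < degree P" using deg degree_smult_le[of a Q] by simp
  have dp1: "degree p1 = d" "lead_coeff p1 = lead_coeff P"
  proof -
    show "degree p1 = d" unfolding p1_def diff_conv_add_uminus
      using degree_add_eq_left[of "- smult a Q" P] lt deg(1) by simp
    then show "lead_coeff p1 = lead_coeff P"
      using lt deg(1) by (simp add: p1_def coeff_eq_0 del: coeff_smult)
  qed
  have p10: "p1 \<noteq> 0" using dp1 deg by auto
  define S where "S = {x. poly p1 x = 0 \<or> poly Q x = 0}"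
  define r where "r = Max ((\<lambda>x. v (x - a)) ` S)"
  have "finite S" unfolding S_def using poly_roots_finite[OF p10] poly_roots_finite[OF nz(2)]
    by (simp add: Collect_disj_eq)
  then have r_ge: "v (x - a) \<le> r" if "x \<in> S" for x using that by (simp add: r_def)
  have "r \<in> (\<lambda>x. v (x - a)) ` S"
    unfolding r_def using \<open>finite S\<close> a by (intro Max_in) (auto simp: S_def)
  then obtain x0 where x0: "x0 \<in> S" "v (x0 - a) = r" by auto
  have "degree p1 > 0" using dp1 deg by simp
  then obtain x1 where x1: "poly p1 x1 = 0" using alg_closed_imp_poly_has_root by blast
  \<comment> \<open>\<open>p1\<close> and \<open>Q\<close> have no common root, so \<open>S\<close>
    contains a point other than \<open>a\<close>, and \<open>r > 0\<close>.\<close>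
  have "x1 \<noteq> a" using x1 a no_common_root[of a] by (auto simp: p1_def)
  then have r0: "r > 0" using r_ge[of x1] x1 abs_pos[of "x1 - a"] by (simp add: S_def del: abs_pos)
  define L where "L = v (lead_coeff Q) / v (lead_coeff P)"
  have L1: "L < 1"
  proof -
    \<comment> \<open>Integers have absolute value at most 1, so a single direction suffices for
      \<open>L < 1\<close>; here it is that of infinity at \<open>\<zeta>(0,1)\<close>.\<close>
    have "L < v (of_nat (dir_degree v p q 0 1 Infty)) ^ d"
      using dir_degree[of 1 0 Infty] multiplier_M by (simp add: L_def is_direction_def)
    also have "\<dots> \<le> 1" using nonneg abs_of_nat_le_1 by (intro power_le_one)
    finally show ?thesis .
  qed
  interpret A: attracting_infinity v p1 Q d L a r
  proof
    show "degree p1 = d" "Suc (degree Q) = d" "d \<ge> 2" by (fact dp1 deg)+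
    show "poly Q x \<noteq> 0" if "poly p1 x = 0" for x
      using that no_common_root[of x] by (auto simp: p1_def)
    show "of_nat m \<noteq> (0 :: 'k)" if "0 < m" "m \<le> d" for m using char that .
    show "L = v (lead_coeff Q) / v (lead_coeff p1)" by (simp only: dp1(2) L_def)
    show "L < 1" "poly Q a = 0" "r > 0" by (fact L1 a r0)+
    show "v (x - a) \<le> r" if "poly p1 x = 0 \<or> poly Q x = 0" for x
      using r_ge[of x] that by (simp add: S_def)
    show "\<exists>x. (poly p1 x = 0 \<or> poly Q x = 0) \<and> v (x - a) = r"
      using x0 by (auto simp: S_def)
    show "L < v (of_nat m) ^ d"
      if "0 < s" "s < e" "0 < m"
        "\<And>x. s < v (x - b) \<Longrightarrow> v (x - b) < e \<Longrightarrow> poly p1 x \<noteq> 0 \<and> poly Q x \<noteq> 0"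
        "num_roots p1 (odisk b e) = num_roots Q (odisk b e) + m" for b s e m
      using multiplier_less[OF that(1-3), of b a] that(4,5) by (simp add: p1_def L_def multiplier_M)
  qed
  define f where "f x = poly P x / poly Q x" for x
  have f: "f x - a = poly p1 x / poly Q x" if "poly Q x \<noteq> 0" for x
    using that by (simp add: f_def p1_def field_simps)
  define X where "X = {x. r < v (x - a)}"
  define U where "U = M ` insert Infty (Fin ` X)"
  have QX: "poly Q x \<noteq> 0" if "x \<in> X" for x using A.outside(1) that by (simp add: X_def)
  have rX: "rat_map p q (M (Fin x)) = M (Fin (f x))" if "x \<in> X" for x
    using rat_map_M[OF QX[OF that]] by (simp add: f_def)
  have fv: "v (f x - a) = v (x - a) / L" if "x \<in> X" for x
    using A.outside(2)[of x] f[OF QX[OF that]] that by (simp add: X_def)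
  have fX: "f x \<in> X" if "x \<in> X" for x
    using A.outside_less[of x] f[OF QX[OF that]] that by (simp add: X_def)
  \<comment> \<open>Each iteration multiplies the distance from \<open>a\<close> by
    \<open>1 / L > 1\<close>. The orbit tends to infinity but consists of finite points.\<close>
  have iter: "(f ^^ n) x \<in> X \<and> (rat_map p q ^^ n) (M (Fin x)) = M (Fin ((f ^^ n) x)) \<and>
    v ((f ^^ n) x - a) = v (x - a) * (1 / L) ^ n" if "x \<in> X" for n x
    by (induction n) (use that fX rX fv in auto)
  have fixn: "(rat_map p q ^^ n) \<gamma> = \<gamma>" for n by (induction n) (simp_all add: fixed)
  have attr: "attracted v p q \<gamma> y" if y: "y \<in> U" for y
  proof -
    consider "y = \<gamma>" | x where "x \<in> X" "y = M (Fin x)" using y M(2) by (auto simp: U_def)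
    then show ?thesis
    proof cases
      case 1
      moreover have "chordal v \<gamma> \<gamma> = 0" by (cases \<gamma>) simp_all
      ultimately show ?thesis by (simp add: attracted_def fixn)
    next
      case 2
      have xa: "v (x - a) > 0" using 2(1) r0 by (simp add: X_def del: abs_pos) 
      have "1 / L > 1" using L1 A.L_pos by simp
      then have "filterlim (\<lambda>n. (1 / L) ^ n) at_top sequentially"
        using A.L_pos
        by (intro filterlim_at_infinity_imp_filterlim_at_top filterlim_realpow_sequentially_gt1) auto
      then have "filterlim (\<lambda>n. v (x - a) * (1 / L) ^ n) at_top sequentially"
        using xa by (intro filterlim_tendsto_pos_mult_at_top[OF tendsto_const])
      then have lim: "filterlim (\<lambda>n. - v a + v ((f ^^ n) x - a)) at_top sequentially"
        using iter[OF 2(1)] by (intro filterlim_tendsto_add_at_top[OF tendsto_const]) simp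
      have "- v a + v ((f ^^ n) x - a) \<le> v ((f ^^ n) x)" for n
        using abs_diff_le[of "(f ^^ n) x" a] nonneg[of a] nonneg[of "(f ^^ n) x"] by linarith
      then have "filterlim (\<lambda>n. v ((f ^^ n) x)) at_top sequentially"
        by (intro filterlim_at_top_mono[OF lim] always_eventually allI)
      from chordal_M[OF this] show ?thesis
        unfolding attracted_def 2(2) using iter[OF 2(1)] by simp
    qed
  qed
  \<comment> \<open>The critical point \<open>x\<close> need not lie in \<open>X\<close>; only its
    value has to.\<close>
  obtain x where x: "poly A.W x = 0" "poly Q x \<noteq> 0" "v (poly p1 x / poly Q x) > r"
    using A.critical_value_exists by blast
  define y where "y = M (Fin (f x))"
  have fxX: "f x \<in> X" using x f[of x] by (simp add: X_def)
  have crit: "critical_value p q y"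
    unfolding critical_value_def critical_point_def
  proof (intro exI conjI)
    show "y = rat_map p q (M (Fin x))" using rat_map_M[OF x(2)] by (simp add: y_def f_def)
    let ?c = "poly p1 x / poly Q x"
    have eq: "P - smult (f x) Q = p1 - smult ?c Q"
      using f[OF x(2)] by (simp add: p1_def smult_diff_left [symmetric] algebra_simps flip: smult_add_left)
    have "order x (p1 - smult ?c Q) \<ge> 2"
    proof (rule order_ge_2)
      show "p1 - smult ?c Q \<noteq> 0"
      proof
        assume "p1 - smult ?c Q = 0"
        then have "p1 = smult ?c Q" by simp
        then have "d \<le> degree Q" using dp1(1) degree_smult_le by metis
        then show False using deg by simp
      qed
      show "poly (p1 - smult ?c Q) x = 0" using x(2) by simp
      show "poly (pderiv (p1 - smult ?c Q)) x = 0"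
        using x(1,2) by (simp add: A.W_def wronskian_def pderiv_diff pderiv_smult field_simps)
    qed
    then show "2 \<le> local_mult p q (M (Fin x))"
      using local_mult_M[OF x(2)] eq by (simp add: f_def)
  qed
  have strict: "strictly_attracted v p q \<gamma> y"
    unfolding strictly_attracted_def
  proof (intro conjI allI impI)
    show "attracted v p q \<gamma> y" using attr fxX by (simp add: U_def y_def)
    \<comment> \<open>The orbit stays among the images of finite points, whereas
      \<open>\<gamma> = M Infty\<close>.\<close>
    show "(rat_map p q ^^ l) y \<noteq> \<gamma>" for l
      using iter[OF fxX, of l] M_eq[of _ Infty] unfolding M(2) y_def by simp
  qed
  show ?thesis
  proof (intro exI conjI)
    show "is_disk v U" using disk_M[OF r0, of a] by (simp add: U_def X_def)
    show "\<gamma> \<in> U" using M(2) by (auto simp: U_def)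
    show "rat_map p q ` U \<subseteq> U" using rX fX fixed M(2) by (auto simp: U_def)
    show "inj_on (rat_map p q) U"
    proof (rule inj_onI)
      have inj: "x = x'" if "x \<in> X" "x' \<in> X" "f x = f x'" for x x'
      proof (rule A.outside_inj)
        show "poly p1 x / poly Q x = poly p1 x' / poly Q x'"
          using f[OF QX] that by metis
      qed (use that in \<open>auto simp: X_def\<close>)
      fix z z' assume z: "z \<in> U" "z' \<in> U" "rat_map p q z = rat_map p q z'"
      have "rat_map p q (M Infty) = M Infty" using fixed M(2) by simp
      then show "z = z'" using z inj rX by (auto simp: U_def)
    qed
    show "\<forall>x\<in>U. attracted v p q \<gamma> x" using attr by blast
    show "\<exists>y\<in>U. critical_value p q y \<and> strictly_attracted v p q \<gamma> y"
      using crit strict fxX by (auto simp: U_def y_def)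
  qed
qed

end

section \<open>Moving a finite fixed point to infinity\<close>

lemma coeff_rev_poly:
  assumes "degree g \<le> n"
  shows "coeff (rev_poly n g) k = (if k \<le> n then coeff g (n - k) else 0)"
  using assms by (auto simp: rev_poly_def coeff_monom_mult coeff_reflect_poly coeff_eq_0)

lemma degree_rev_poly_le: "degree g \<le> n \<Longrightarrow> degree (rev_poly n g) \<le> n"
  by (rule degree_le) (simp add: coeff_rev_poly)

lemma poly_rev_poly:
  assumes "degree g \<le> n" "w \<noteq> 0"
  shows "poly (rev_poly n g) w = w ^ n * poly g (1 / w)"
proof -
  have "w ^ (n - degree g) * w ^ degree g = w ^ n" using assms(1) by (simp flip: power_add)
  then show ?thesis using assms(2)
    by (simp add: rev_poly_def poly_monom poly_reflect_poly_nz field_simps)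
qed

lemma poly_rev_poly_0: "degree g \<le> n \<Longrightarrow> poly (rev_poly n g) 0 = coeff g n"
  by (simp add: poly_0_coeff_0 coeff_rev_poly)

lemma rev_poly_diff_smult:
  assumes "degree f \<le> n" "degree g \<le> n"
  shows "rev_poly n (f - smult c g) = rev_poly n f - smult c (rev_poly n g)"
proof -
  have "degree (f - smult c g) \<le> n"
    using assms degree_smult_le[of c g] by (intro degree_diff_le) auto
  then show ?thesis using assms by (intro poly_eqI) (simp add: coeff_rev_poly)
qed

lemma rev_poly_smult: "degree g \<le> n \<Longrightarrow> rev_poly n (smult c g) = smult c (rev_poly n g)"
  using degree_smult_le[of c g] by (intro poly_eqI) (simp add: coeff_rev_poly)

lemma order_eqI:
  assumes "poly h a \<noteq> 0" "g = [:-a, 1:] ^ k * h"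
  shows "order a g = k"
proof -
  have "\<not> [:-a, 1:] ^ Suc k dvd g"
  proof
    assume "[:-a, 1:] ^ Suc k dvd g"
    then have "[:-a, 1:] ^ k * [:-a, 1:] dvd [:-a, 1:] ^ k * h"
      unfolding assms(2) power_Suc2 .
    then have "[:-a, 1:] dvd h" by (subst (asm) dvd_mult_cancel_left) auto
    then show False using assms(1) by (simp add: poly_eq_0_iff_dvd)
  qed
  then show ?thesis using order_unique_lemma[of a k g] assms(2) by simp
qed

text \<open>The degree that \<open>g\<close> lacks from \<open>n\<close> is the multiplicity of the
  root at infinity, which \<open>1 / w\<close> moves to 0.\<close>

lemma order_rev_poly_0:
  assumes "g \<noteq> 0" "degree g \<le> n"
  shows "order 0 (rev_poly n g) = n - degree g"
  by (rule order_eqI[of "reflect_poly g"]) (use assms in \<open>auto simp: rev_poly_def monom_altdef\<close>)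

lemma order_rev_poly:
  fixes g :: "'k::field poly"
  assumes "g \<noteq> 0" "w \<noteq> 0"
  shows "order w (rev_poly n g) = order (1 / w) g"
proof -
  define k where "k = order (1 / w) g"
  obtain h where h: "g = [:-(1 / w), 1:] ^ k * h" "\<not> [:-(1 / w), 1:] dvd h"
    using order_decomp[OF assms(1)] unfolding k_def by blast
  have rp: "reflect_poly [:-(1 / w), 1:] = smult (- (1 / w)) [:-w, 1:]"
    using assms(2) by (simp add: reflect_poly_pCons)
  have "reflect_poly g = [:-w, 1:] ^ k * smult ((- (1 / w)) ^ k) (reflect_poly h)"
    unfolding h(1) reflect_poly_mult reflect_poly_power rp smult_power by simp
  then have "rev_poly n g = [:-w, 1:] ^ k * (monom ((- (1 / w)) ^ k) (n - degree g) * reflect_poly h)"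
  proof -
    define K where "K = (- (1 / w)) ^ k"
    have "monom K (n - degree g) = smult K (monom 1 (n - degree g))" by (simp add: smult_monom)
    then show ?thesis using \<open>reflect_poly g = _\<close> by (simp add: rev_poly_def mult_ac flip: K_def)
  qed
  moreover have "poly h (1 / w) \<noteq> 0" using h(2) by (simp add: poly_eq_0_iff_dvd)
  then have "poly (monom ((- (1 / w)) ^ k) (n - degree g) * reflect_poly h) w \<noteq> 0"
    using assms(2) by (simp add: poly_monom poly_reflect_poly_nz inverse_eq_divide)
  ultimately show ?thesis unfolding k_def by (intro order_eqI) auto
qed

lemma order_shift:
  fixes g :: "'k::field poly"
  assumes "g \<noteq> 0"
  shows "order w (g \<circ>\<^sub>p [:c, 1:]) = order (c + w) g"
proof -
  define k where "k = order (c + w) g"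
  obtain h where h: "g = [:-(c + w), 1:] ^ k * h" "\<not> [:-(c + w), 1:] dvd h"
    using order_decomp[OF assms] unfolding k_def by blast
  have "[:-(c + w), 1:] \<circ>\<^sub>p [:c, 1:] = [:-w, 1:]" by (simp add: pcompose_pCons)
  moreover have "(f ^ n) \<circ>\<^sub>p [:c, 1:] = (f \<circ>\<^sub>p [:c, 1:]) ^ n" for f :: "'k poly" and n
    by (induction n) (simp_all add: pcompose_mult pcompose_1)
  ultimately have "g \<circ>\<^sub>p [:c, 1:] = [:-w, 1:] ^ k * (h \<circ>\<^sub>p [:c, 1:])"
    unfolding h(1) pcompose_mult by simp
  moreover have "poly (h \<circ>\<^sub>p [:c, 1:]) w \<noteq> 0" using h(2) by (simp add: poly_eq_0_iff_dvd poly_pcompose)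
  ultimately show ?thesis unfolding k_def by (intro order_eqI) auto
qed

section \<open>The coordinate \<open>w\<close> with \<open>z = c + 1 / w\<close>\<close>

fun inv_coord :: "'k::field \<Rightarrow> 'k proj_line \<Rightarrow> 'k proj_line" where
  "inv_coord c (Fin w) = (if w = 0 then Infty else Fin (c + 1 / w))"
| "inv_coord c Infty = Fin c"

text \<open>For \<open>n \<ge> degree g\<close> this is \<open>w ^ n * g (c + 1 / w)\<close>, the
  pullback of \<open>g\<close> with denominators cleared.\<close>

definition at_inv_coord :: "nat \<Rightarrow> 'k::field \<Rightarrow> 'k poly \<Rightarrow> 'k poly" where
  "at_inv_coord n c g = rev_poly n (g \<circ>\<^sub>p [:c, 1:])"

lemma bij_inv_coord: "bij (inv_coord c)"
proof (rule bijI')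
  show "inv_coord c x = inv_coord c y \<longleftrightarrow> x = y" for x y
    by (cases x; cases y) auto
  show "\<exists>x. y = inv_coord c x" for y
  proof (cases y)
    case (Fin z)
    show ?thesis
    proof (cases "z = c")
      case True
      then show ?thesis using Fin by (intro exI[of _ Infty]) simp
    next
      case False
      then show ?thesis using Fin by (intro exI[of _ "Fin (1 / (z - c))"]) simp
    qed
  next
    case Infty
    then show ?thesis by (intro exI[of _ "Fin 0"]) simp
  qed
qed

lemma coeff_pcompose_degree:
  fixes g :: "'k::field poly"
  assumes "degree g \<le> n"
  shows "coeff (g \<circ>\<^sub>p [:c, 1:]) n = coeff g n"
proof (cases "degree g = n")
  case True
  have "lead_coeff (g \<circ>\<^sub>p [:c, 1:]) = lead_coeff g"
    by (subst lead_coeff_comp) auto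
  then show ?thesis using True by (simp add: degree_pcompose)
next
  case False
  then have "degree g < n" using assms by simp
  then show ?thesis by (simp add: coeff_eq_0 degree_pcompose)
qed

lemma poly_at_inv_coord:
  fixes g :: "'k::field poly"
  assumes "degree g \<le> n"
  shows "poly (at_inv_coord n c g) w = (if w = 0 then coeff g n else w ^ n * poly g (c + 1 / w))"
proof -
  have "degree (g \<circ>\<^sub>p [:c, 1:]) \<le> n" using assms by (simp add: degree_pcompose)
  then show ?thesis
    using assms by (simp add: at_inv_coord_def poly_rev_poly poly_rev_poly_0 coeff_pcompose_degree poly_pcompose)
qed

lemma at_inv_coord_diff_smult:
  fixes f g :: "'k::field poly"
  assumes "degree f \<le> n" "degree g \<le> n"
  shows "at_inv_coord n c (f - smult y g) = at_inv_coord n c f - smult y (at_inv_coord n c g)"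
  using assms rev_poly_diff_smult[of "f \<circ>\<^sub>p [:c, 1:]" n "g \<circ>\<^sub>p [:c, 1:]" y]
  by (simp add: at_inv_coord_def pcompose_diff pcompose_smult degree_pcompose)

lemma at_inv_coord_smult:
  fixes g :: "'k::field poly"
  assumes "degree g \<le> n"
  shows "at_inv_coord n c (smult y g) = smult y (at_inv_coord n c g)"
  using assms rev_poly_smult[of "g \<circ>\<^sub>p [:c, 1:]" n y]
  by (simp add: at_inv_coord_def pcompose_smult degree_pcompose)

text \<open>Reversal puts the Taylor coefficients at \<open>c\<close> at the top, so the value and
  the derivative at \<open>c\<close> appear in degrees \<open>n\<close> and \<open>n - 1\<close>.
  They determine the degrees and the multiplier of the transformed map.\<close>

lemma coeff_at_inv_coord:
  fixes g :: "'k::field poly"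
  assumes "degree g \<le> n"
  shows "coeff (at_inv_coord n c g) n = poly g c"
    "n \<ge> 1 \<Longrightarrow> coeff (at_inv_coord n c g) (n - 1) = poly (pderiv g) c"
    "degree (at_inv_coord n c g) \<le> n"
proof -
  have d: "degree (g \<circ>\<^sub>p [:c, 1:]) \<le> n" using assms by (simp add: degree_pcompose)
  show "degree (at_inv_coord n c g) \<le> n"
    using degree_rev_poly_le[OF d] by (simp add: at_inv_coord_def)
  show "coeff (at_inv_coord n c g) n = poly g c"
    using d by (simp add: at_inv_coord_def coeff_rev_poly poly_pcompose flip: poly_0_coeff_0)
  have "coeff (g \<circ>\<^sub>p [:c, 1:]) 1 = poly (pderiv (g \<circ>\<^sub>p [:c, 1:])) 0"
    by (simp add: poly_0_coeff_0 coeff_pderiv)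
  then show "coeff (at_inv_coord n c g) (n - 1) = poly (pderiv g) c" if "n \<ge> 1"
    using d that by (simp add: at_inv_coord_def coeff_rev_poly pderiv_pcompose poly_pcompose pderiv_pCons)
qed

text \<open>In the coordinate \<open>w\<close> the map becomes
  \<open>1 / (p / q - c) = q / (p - c * q)\<close>. Fibre polynomials over corresponding values
  agree up to a scalar, and at infinity the missing degree becomes the order at
  \<open>w = 0\<close>, so multiplicities are preserved.\<close>

lemma local_mult_inv_coord:
  fixes p q :: "'k::field poly"
  assumes d: "rat_degree p q = d" and c: "poly p c = c * poly q c"
    and w: "poly (at_inv_coord d c (p - smult c q)) w \<noteq> 0"
    and nz: "\<And>y. fibre_poly p q y \<noteq> 0"
  defines "y \<equiv> poly (at_inv_coord d c q) w / poly (at_inv_coord d c (p - smult c q)) w"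
  shows "rat_map p q (inv_coord c (Fin w)) = inv_coord c (Fin y)"
    "local_mult p q (inv_coord c (Fin w)) =
      order w (at_inv_coord d c q - smult y (at_inv_coord d c (p - smult c q)))"
proof -
  let ?g = "p - smult c q"
  have deg: "degree p \<le> d" "degree q \<le> d" using d by (auto simp: rat_degree_def)
  then have degg: "degree ?g \<le> d" using degree_smult_le[of c q] by (intro degree_diff_le) auto
  show rm: "rat_map p q (inv_coord c (Fin w)) = inv_coord c (Fin y)"
  proof (cases "w = 0")
    case True
    then show ?thesis using deg degg d w
      by (simp add: y_def poly_at_inv_coord Let_def field_simps)
  next
    case False
    then have g: "poly p (c + 1 / w) - c * poly q (c + 1 / w) \<noteq> 0"
      using w degg by (simp add: poly_at_inv_coord)
    have y: "y = poly q (c + 1 / w) / (poly p (c + 1 / w) - c * poly q (c + 1 / w))"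
      using False deg degg by (simp add: y_def poly_at_inv_coord)
    show ?thesis using False g unfolding y by (simp add: field_simps)
  qed
  define Y where "Y = inv_coord c (Fin y)"
  define h where "h = fibre_poly p q Y"
  have h0: "h \<noteq> 0" using nz by (simp add: h_def)
  have dh: "degree h \<le> d"
    using deg degree_smult_le degree_diff_le unfolding h_def
    by (cases Y) (auto intro!: degree_diff_le intro: order_trans[OF degree_smult_le])
  \<comment> \<open>If \<open>y \<noteq> 0\<close>, the value is \<open>c + 1 / y\<close> and
    \<open>p - (c + 1 / y) * q = - (1 / y) * (q - y * (p - c * q))\<close>. If \<open>y = 0\<close>,
    the value is infinity, with fibre polynomial \<open>q\<close>.\<close>
  obtain k where k: "k \<noteq> 0" "h = smult k (q - smult y ?g)"
  proof (cases "y = 0")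
    case True
    then show ?thesis using that[of 1] by (simp add: h_def Y_def)
  next
    case False
    then have "h = smult (- (1 / y)) (q - smult y ?g)"
      by (simp add: h_def Y_def smult_diff_right smult_add_left)
    then show ?thesis using that[of "- (1 / y)"] False by simp
  qed
  have dk: "degree (q - smult y ?g) \<le> d" using k dh by simp
  have eq: "at_inv_coord d c h = smult k (at_inv_coord d c q - smult y (at_inv_coord d c ?g))"
    unfolding k(2) at_inv_coord_smult[OF dk] at_inv_coord_diff_smult[OF deg(2) degg] ..
  have ho: "h \<circ>\<^sub>p [:c, 1:] \<noteq> 0" "degree (h \<circ>\<^sub>p [:c, 1:]) = degree h"
    using h0 by (auto simp: pcompose_eq_0_iff degree_pcompose)
  have "local_mult p q (inv_coord c (Fin w)) = order w (at_inv_coord d c h)"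
  proof (cases "w = 0")
    case True
    then have "local_mult p q (inv_coord c (Fin w)) = d - degree h"
      using rm d by (simp add: h_def Y_def del: rat_map.simps)
    also have "\<dots> = order 0 (at_inv_coord d c h)"
      using order_rev_poly_0[of "h \<circ>\<^sub>p [:c, 1:]" d] ho dh by (simp add: at_inv_coord_def)
    finally show ?thesis using True by simp
  next
    case False
    then have "local_mult p q (inv_coord c (Fin w)) = order (c + 1 / w) h"
      using rm by (simp add: h_def Y_def del: rat_map.simps)
    also have "\<dots> = order w (at_inv_coord d c h)"
      using order_rev_poly[of "h \<circ>\<^sub>p [:c, 1:]" w d] ho(1) False order_shift[OF h0] by (simp add: at_inv_coord_def)
    finally show ?thesis .
  qed
  then show "local_mult p q (inv_coord c (Fin w)) =
      order w (at_inv_coord d c q - smult y (at_inv_coord d c ?g))"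
    unfolding eq using k(1) by (simp add: order_smult)
qed

section \<open>Annuli, directions and disks under the change of coordinate\<close>

context alg_closed_nonarch_abs
begin

text \<open>Points nearer to \<open>b\<close> than 0 is satisfy \<open>v x = v b\<close>, and among
  them inversion divides distances by \<open>(v b)\<^sup>2\<close>. The predicate \<open>I\<close>
  on radii covers annuli and closed disks alike.\<close>

lemma inv_coord_image_far:
  assumes "\<And>t. I t \<Longrightarrow> t < v b"
  shows "inv_coord c ` Fin ` {x. I (v (x - b))} = Fin ` {z. I (v (z - (c + 1 / b)) * (v b)\<^sup>2)}"
proof (intro equalityI subsetI)
  fix z assume "z \<in> inv_coord c ` Fin ` {x. I (v (x - b))}"
  then obtain x where x: "I (v (x - b))" "z = inv_coord c (Fin x)" by auto
  have b0: "b \<noteq> 0" using assms[OF x(1)] nonneg[of "x - b"] by auto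
  have vx: "v x = v b" using abs_add_eq[of "x - b" b] assms[OF x(1)] by simp
  then have x0: "x \<noteq> 0" using b0 by (metis abs_pos abs_0 less_irrefl)
  have "c + 1 / x - (c + 1 / b) = (b - x) / (x * b)" using x0 b0 by (simp add: field_simps)
  then have "v (c + 1 / x - (c + 1 / b)) * (v b)\<^sup>2 = v (x - b)"
    using vx b0 by (simp add: abs_divide mult abs_minus_commute[of b x] power2_eq_square eq_0_iff)
  then show "z \<in> Fin ` {z. I (v (z - (c + 1 / b)) * (v b)\<^sup>2)}" using x x0 by simp
next
  fix z' assume "z' \<in> Fin ` {z. I (v (z - (c + 1 / b)) * (v b)\<^sup>2)}"
  then obtain z where z: "z' = Fin z" "I (v (z - (c + 1 / b)) * (v b)\<^sup>2)" by auto
  define u where "u = z - c"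
  have I: "I (v (u - 1 / b) * (v b)\<^sup>2)" using z(2) by (simp add: u_def algebra_simps)
  have lt: "v (u - 1 / b) * (v b)\<^sup>2 < v b" using assms[OF I] .
  have b0: "b \<noteq> 0" using lt by auto
  then have vb: "v b > 0" by simp
  have "v (u - 1 / b) < v (1 / b)"
    using lt vb by (simp add: abs_divide power2_eq_square field_simps)
  then have vu: "v u = v (1 / b)" using abs_add_eq[of "u - 1 / b" "1 / b"] by simp
  then have u0: "u \<noteq> 0" using b0 by (metis abs_0 eq_0_iff divide_eq_0_iff one_neq_zero)
  have "1 / u - b = - ((u - 1 / b) * b / u)" using u0 b0 by (simp add: field_simps)
  then have "v (1 / u - b) = v (u - 1 / b) * v b / v u" by (simp add: abs_divide mult)
  also have "\<dots> = v (u - 1 / b) * (v b)\<^sup>2"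
    unfolding vu using vb by (simp add: abs_divide power2_eq_square)
  finally have "I (v (1 / u - b))" using I by simp
  moreover have "inv_coord c (Fin (1 / u)) = z'" using u0 z(1) by (simp add: u_def)
  ultimately show "z' \<in> inv_coord c ` Fin ` {x. I (v (x - b))}" by (metis (mono_tags) imageI mem_Collect_eq)
qed

lemma inv_coord_annulus_far:
  assumes "t \<le> v b" "b \<noteq> 0"
  shows "inv_coord c ` Fin ` annulus b s t = Fin ` annulus (c + 1 / b) (s / (v b)\<^sup>2) (t / (v b)\<^sup>2)"
proof -
  have "0 < (v b)\<^sup>2" using assms(2) by (simp add: eq_0_iff)
  then show ?thesis
    using inv_coord_image_far[of "\<lambda>u. s < u \<and> u < t" b c] assms
    by (simp add: annulus_def pos_divide_less_eq pos_less_divide_eq)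
qed

lemma annulus_near: "v b \<le> s \<Longrightarrow> annulus b s t = annulus 0 s t"
proof -
  assume b: "v b \<le> s"
  have "s < v (x - b) \<and> v (x - b) < t \<longleftrightarrow> s < v x \<and> v x < t" for x
    using abs_add_eq'[of "- b" x] abs_add_eq'[of b "x - b"] b by fastforce
  then show ?thesis by (simp add: annulus_def)
qed

text \<open>The annulus surrounds 0, so it may be centred there, and inversion inverts both
  radii.\<close>

lemma inv_coord_annulus_near:
  assumes "v b \<le> s" "0 < s" "s < t"
  shows "inv_coord c ` Fin ` annulus b s t = Fin ` annulus c (1 / t) (1 / s)"
  unfolding annulus_near[OF assms(1)]
proof (intro equalityI subsetI)
  fix z assume "z \<in> inv_coord c ` Fin ` annulus 0 s t"
  then obtain x where x: "s < v x" "v x < t" "z = inv_coord c (Fin x)" by (auto simp: annulus_def)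
  then have "x \<noteq> 0" "0 < v x" using assms by auto
  then show "z \<in> Fin ` annulus c (1 / t) (1 / s)"
    using x assms by (simp add: annulus_def abs_divide frac_less2 del: abs_pos)
next
  fix z' assume "z' \<in> Fin ` annulus c (1 / t) (1 / s)"
  then obtain z where z: "z' = Fin z" "1 / t < v (z - c)" "v (z - c) < 1 / s" by (auto simp: annulus_def)
  have p: "0 < v (z - c)" using z(2) assms by (smt (verit) zero_less_divide_1_iff)
  then have "z \<noteq> c" by simp
  moreover have "1 / (z - c) \<in> annulus 0 s t"
    using z p assms by (simp add: annulus_def abs_divide field_simps del: abs_pos)
  ultimately show "z' \<in> inv_coord c ` Fin ` annulus 0 s t"
    using z(1) by (intro image_eqI[of _ _ "Fin (1 / (z - c))"]) auto
qed

text \<open>If the closed disk of radius \<open>s\<close> around \<open>b\<close> contains 0, the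
  upward direction becomes that of \<open>c\<close> at \<open>\<zeta>(c,1/s)\<close>; otherwise it
  becomes that of infinity at \<open>\<zeta>(c + 1/b, s/(v b)\<^sup>2)\<close>.\<close>

lemma inv_coord_direction:
  assumes "0 < s"
  shows "\<exists>a r w. 0 < r \<and> is_direction v a r w \<and>
    (\<forall>e>0. \<exists>e'>0. \<forall>\<eta>. 0 < \<eta> \<and> \<eta> < e' \<longrightarrow>
      (\<exists>\<epsilon>. 0 < \<epsilon> \<and> \<epsilon> \<le> e \<and> dir_annulus v a r w \<eta> = inv_coord c ` Fin ` annulus b s (s + \<epsilon>)))"
proof (cases "v b \<le> s")
  case True
  have "\<exists>e'>0. \<forall>\<eta>. 0 < \<eta> \<and> \<eta> < e' \<longrightarrow>
      (\<exists>\<epsilon>. 0 < \<epsilon> \<and> \<epsilon> \<le> e \<and> dir_annulus v c (1 / s) (Fin c) \<eta> = inv_coord c ` Fin ` annulus b s (s + \<epsilon>))"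
    if e: "e > 0" for e
  proof (rule exI[of _ "1 / s - 1 / (s + e)"], intro conjI allI impI)
    show "0 < 1 / s - 1 / (s + e)" using assms e frac_less2[of 1 1 s "s + e"] by simp
    fix \<eta> assume \<eta>: "0 < \<eta> \<and> \<eta> < 1 / s - 1 / (s + e)"
    \<comment> \<open>The solution of \<open>1 / t = 1 / s - \<eta>\<close>; the widths of the two
      annuli are not proportional here.\<close>
    define t where "t = 1 / (1 / s - \<eta>)"
    have "1 / (s + e) > 0" using assms e by simp
    then have pos: "1 / s - \<eta> > 1 / (s + e)" "1 / s - \<eta> > 0" "1 / s - \<eta> < 1 / s" using \<eta> by linarith+
    have "t > s" using pos assms unfolding t_def by (simp add: field_simps)
    moreover have "t < s + e"
      using pos assms e unfolding t_def by (simp add: divide_less_eq) (simp add: field_simps)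
    moreover have "dir_annulus v c (1 / s) (Fin c) \<eta> = Fin ` annulus c (1 / t) (1 / s)"
      by (simp add: annulus_def t_def)
    ultimately show "\<exists>\<epsilon>. 0 < \<epsilon> \<and> \<epsilon> \<le> e \<and> dir_annulus v c (1 / s) (Fin c) \<eta> = inv_coord c ` Fin ` annulus b s (s + \<epsilon>)"
      using inv_coord_annulus_near[OF True assms, of t c] by (intro exI[of _ "t - s"]) simp
  qed
  moreover have "0 < 1 / s" "is_direction v c (1 / s) (Fin c)"
    using assms by (auto simp: is_direction_def closed_disk_def)
  ultimately show ?thesis by blast
next
  case False
  then have b: "b \<noteq> 0" "0 < v b" using assms by auto
  let ?k = "(v b)\<^sup>2"
  have k: "?k > 0" using b(2) by (rule zero_less_power)
  have "\<exists>e'>0. \<forall>\<eta>. 0 < \<eta> \<and> \<eta> < e' \<longrightarrow>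
      (\<exists>\<epsilon>. 0 < \<epsilon> \<and> \<epsilon> \<le> e \<and> dir_annulus v (c + 1 / b) (s / ?k) Infty \<eta> = inv_coord c ` Fin ` annulus b s (s + \<epsilon>))"
    if e: "e > 0" for e
  \<comment> \<open>The bound \<open>v b - s\<close> keeps the annulus around \<open>b\<close> away
    from 0.\<close>
  proof (rule exI[of _ "min e (v b - s) / ?k"], intro conjI allI impI)
    show "0 < min e (v b - s) / ?k" using e k False by simp
    fix \<eta> assume \<eta>: "0 < \<eta> \<and> \<eta> < min e (v b - s) / ?k"
    then have \<epsilon>: "0 < \<eta> * ?k" "\<eta> * ?k < min e (v b - s)" using k by (simp_all add: pos_less_divide_eq)
    have "s / ?k + \<eta> = (s + \<eta> * ?k) / ?k" using k by (simp add: field_simps)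
    then have "dir_annulus v (c + 1 / b) (s / ?k) Infty \<eta> = Fin ` annulus (c + 1 / b) (s / ?k) ((s + \<eta> * ?k) / ?k)"
      by (simp add: annulus_def)
    also have "\<dots> = inv_coord c ` Fin ` annulus b s (s + \<eta> * ?k)"
      using \<epsilon> b by (intro inv_coord_annulus_far[symmetric]) auto
    finally show "\<exists>\<epsilon>. 0 < \<epsilon> \<and> \<epsilon> \<le> e \<and>
        dir_annulus v (c + 1 / b) (s / ?k) Infty \<eta> = inv_coord c ` Fin ` annulus b s (s + \<epsilon>)"
      using \<epsilon> by (intro exI[of _ "\<eta> * ?k"]) simp
  qed
  moreover have "0 < s / ?k" "is_direction v (c + 1 / b) (s / ?k) Infty"
    using assms k by (auto simp: is_direction_def)
  ultimately show ?thesis by blast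
qed

lemma inv_coord_open_annulus:
  assumes "0 < s"
  shows "\<exists>e>s. \<forall>t. s < t \<and> t < e \<longrightarrow> is_open_annulus v (inv_coord c ` Fin ` annulus b s t)"
proof (cases "v b \<le> s")
  case True
  then show ?thesis
    using assms is_open_annulus_Fin[of "1 / t" "1 / s" c for t]
    by (intro exI[of _ "s + 1"]) (auto simp: inv_coord_annulus_near frac_less2)
next
  case False
  then have b: "b \<noteq> 0" "0 < (v b)\<^sup>2" using assms by auto
  show ?thesis
  proof (intro exI[of _ "v b"] conjI allI impI)
    fix t assume t: "s < t \<and> t < v b"
    then show "is_open_annulus v (inv_coord c ` Fin ` annulus b s t)"
      using assms b by (simp add: inv_coord_annulus_far is_open_annulus_Fin divide_strict_right_mono)
  qed (use False in simp)
qed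

lemma complement_closed_disk: "- closed_disk v b s = insert Infty (Fin ` {x. s < v (x - b)})"
proof (rule set_eqI)
  fix z show "z \<in> - closed_disk v b s \<longleftrightarrow> z \<in> insert Infty (Fin ` {x. s < v (x - b)})"
    by (cases z) (auto simp: closed_disk_def)
qed

text \<open>If the removed closed disk contains 0, its exterior goes to an open disk around
  \<open>c\<close>. Otherwise the removed disk goes to a closed disk and, by bijectivity, its
  exterior to the complement.\<close>

lemma inv_coord_disk:
  assumes "0 < s"
  shows "is_disk v (inv_coord c ` insert Infty (Fin ` {x. s < v (x - b)}))"
proof (cases "v b \<le> s")
  case True
  have "s < v (x - b) \<longleftrightarrow> s < v x" for x
    using abs_add_eq'[of "- b" x] abs_add_eq'[of b "x - b"] True by fastforce
  then have "inv_coord c ` insert Infty (Fin ` {x. s < v (x - b)}) = insert (Fin c) (inv_coord c ` Fin ` {x. s < v x})"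
    by simp
  also have "\<dots> = open_disk v c (1 / s)"
  proof (intro equalityI subsetI)
    fix z assume "z \<in> insert (Fin c) (inv_coord c ` Fin ` {x. s < v x})"
    then consider "z = Fin c" | x where "s < v x" "z = inv_coord c (Fin x)" by auto
    then show "z \<in> open_disk v c (1 / s)"
    proof cases
      case 1
      then show ?thesis using assms by (simp add: open_disk_def)
    next
      case 2
      then have "x \<noteq> 0" using assms by auto
      then show ?thesis using 2 assms by (simp add: open_disk_def abs_divide frac_less2)
    qed
  next
    fix z' assume "z' \<in> open_disk v c (1 / s)"
    then obtain z where z: "z' = Fin z" "v (z - c) < 1 / s" by (auto simp: open_disk_def)
    show "z' \<in> insert (Fin c) (inv_coord c ` Fin ` {x. s < v x})"
    proof (cases "z = c")
      case False
      then have "0 < v (z - c)" by simp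
      then have "s < v (1 / (z - c))" using z(2) assms by (simp add: abs_divide field_simps del: abs_pos)
      moreover have "z' = inv_coord c (Fin (1 / (z - c)))" using z(1) False by simp
      ultimately show ?thesis by blast
    qed (use z in simp)
  qed
  finally show ?thesis unfolding is_disk_def using assms by (metis zero_less_divide_1_iff)
next
  case False
  then have b: "b \<noteq> 0" "0 < (v b)\<^sup>2" using assms by auto
  have "inv_coord c ` closed_disk v b s = closed_disk v (c + 1 / b) (s / (v b)\<^sup>2)"
    using inv_coord_image_far[of "\<lambda>t. t \<le> s" b c] False b
    by (simp add: closed_disk_def pos_le_divide_eq)
  then have "inv_coord c ` insert Infty (Fin ` {x. s < v (x - b)}) = - closed_disk v (c + 1 / b) (s / (v b)\<^sup>2)"
    unfolding complement_closed_disk[symmetric] by (simp only: bij_image_Compl_eq[OF bij_inv_coord])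
  then show ?thesis unfolding is_disk_def using assms b by (metis zero_less_divide_iff)
qed

text \<open>The distance from \<open>c + 1 / w\<close> to \<open>c\<close> is
  \<open>1 / v w\<close>, and the chordal distance is not larger.\<close>

lemma inv_coord_chordal:
  assumes "filterlim (\<lambda>n. v (w n)) at_top sequentially"
  shows "(\<lambda>n. chordal v (inv_coord c (Fin (w n))) (Fin c)) \<longlonglongrightarrow> 0"
proof (rule tendsto_sandwich)
  have pos: "\<forall>\<^sub>F n in sequentially. 0 < v (w n)"
    using assms by (rule eventually_compose_filterlim[OF eventually_gt_at_top])
  have "0 \<le> chordal v x y" for x y by (cases x; cases y) (auto simp: nonneg intro!: divide_nonneg_nonneg mult_nonneg_nonneg)
  then show "\<forall>\<^sub>F n in sequentially. 0 \<le> chordal v (inv_coord c (Fin (w n))) (Fin c)" by simp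
  show "\<forall>\<^sub>F n in sequentially. chordal v (inv_coord c (Fin (w n))) (Fin c) \<le> inverse (v (w n))"
    using pos
  proof eventually_elim
    case (elim n)
    then have "w n \<noteq> 0" by simp
    then have "chordal v (inv_coord c (Fin (w n))) (Fin c) =
      inverse (v (w n)) / (max 1 (v (c + 1 / w n)) * max 1 (v c))"
      by (simp add: abs_divide inverse_eq_divide)
    also have "\<dots> \<le> inverse (v (w n)) / 1"
    proof (rule divide_left_mono)
      show "1 \<le> max 1 (v (c + 1 / w n)) * max 1 (v c)" by (rule mult_ge1_I) auto
    qed (use elim in \<open>auto simp: nonneg\<close>)
    finally show ?case by simp
  qed
  show "(\<lambda>n. inverse (v (w n))) \<longlonglongrightarrow> 0"
    using tendsto_inverse_0_at_top[OF assms] .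
qed simp

end

text \<open>Both cases instantiate \<open>normal_form\<close>: with the identity if the fixed point
  is infinity, and with \<open>inv_coord c\<close> if it is \<open>c\<close>.\<close>

theorem theorem4p1:
  fixes v :: "'k::alg_closed_field \<Rightarrow> real"
    and p q :: "'k poly" and d :: nat and \<gamma> :: "'k proj_line"
  assumes "complete_nonarch_abs v"
    and "coprime p q" and "q \<noteq> 0" and "rat_degree p q = d" and "d \<ge> 2"
    and "CHAR('k) = 0 \<or> CHAR('k) > d"
    and "rat_map p q \<gamma> = \<gamma>"
    and "\<And>a r w. r > 0 \<Longrightarrow> is_direction v a r w \<Longrightarrow>
           0 < v (multiplier p q \<gamma>) \<and>
           v (multiplier p q \<gamma>) < v (of_nat (dir_degree v p q a r w)) ^ d"
  shows "\<exists>U. is_disk v U \<and> \<gamma> \<in> U \<and>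
           rat_map p q ` U \<subseteq> U \<and> inj_on (rat_map p q) U \<and>
           (\<forall>x\<in>U. attracted v p q \<gamma> x) \<and>
           (\<exists>y\<in>U. critical_value p q y \<and> strictly_attracted v p q \<gamma> y)"
proof -
  interpret complete_nonarch_abs v by fact
  interpret alg_closed_nonarch_abs v ..
  have "v (multiplier p q \<gamma>) > 0"
    using assms(8)[of 1 0 Infty] by (simp add: is_direction_def)
  then have mult0: "multiplier p q \<gamma> \<noteq> 0" by simp
  have char: "of_nat m \<noteq> (0 :: 'k)" if "0 < m" "m \<le> d" for m
    using assms(6) that by (auto simp: of_nat_eq_0_iff_char_dvd dest: dvd_imp_le)
  have deg: "degree p \<le> d" "degree q \<le> d" using assms(4) by (auto simp: rat_degree_def)
  have common: False if "poly p x = 0" "poly q x = 0" for x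
  proof -
    have "is_unit [:-x, 1:]"
      using that by (intro coprime_common_divisor[OF assms(2)]) (simp_all add: poly_eq_0_iff_dvd [symmetric])
    then have "degree [:-x, 1:] = 0" by (subst (asm) is_unit_iff_degree) simp_all
    then show False by simp
  qed
  have dd: "v (multiplier p q \<gamma>) < v (of_nat (dir_degree v p q a r w)) ^ d"
    if "r > 0" "is_direction v a r w" for a r w
    using assms(8)[OF that] by simp
  show ?thesis
  proof (cases \<gamma>)
    case Infty
    \<comment> \<open>That infinity is fixed means \<open>degree q < d\<close>; the nonzero
      multiplier then forces \<open>degree q = d - 1\<close>.\<close>
    have cq: "coeff q d = 0" using assms(4,7) Infty by (auto simp: Let_def split: if_splits)
    have dq: "degree q < d"
    proof (rule ccontr)
      assume "\<not> degree q < d"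
      then have "degree q = d" using deg by simp
      then show False using cq assms(3) by (metis leading_coeff_0_iff)
    qed
    then have dp: "degree p = d" using assms(4) deg by (auto simp: rat_degree_def max_def split: if_splits)
    have pd: "poly (pderiv (rev_poly d q)) 0 = coeff q (d - 1)"
      using deg assms(5) by (simp add: poly_0_coeff_0 coeff_pderiv coeff_rev_poly)
    have mul: "multiplier p q Infty = coeff q (d - 1) / coeff p d"
      using deg assms(4) dp assms(5) cq pd
      by (auto simp: Let_def rat_deriv_def poly_rev_poly_0 power2_eq_square)
    then have "coeff q (d - 1) \<noteq> 0" using mult0 Infty by auto
    then have dq': "degree q = d - 1" using le_degree[of q "d - 1"] dq by simp
    interpret normal_form v p q p q d \<gamma> id
    proof
      show "degree p = d" "d \<ge> 2" by (fact dp assms(5))+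
      show "Suc (degree q) = d" using dq' assms(5) by simp
      show "poly q x \<noteq> 0" if "poly p x = 0" for x using common that by blast
      show "of_nat m \<noteq> (0 :: 'k)" if "0 < m" "m \<le> d" for m using char that .
      show "rat_map p q \<gamma> = \<gamma>" by (fact assms(7))
      show "inj (id :: 'k proj_line \<Rightarrow> _)" "id Infty = \<gamma>" by (simp_all add: Infty)
      show "v (multiplier p q \<gamma>) = v (lead_coeff q) / v (lead_coeff p)"
        using mul dp dq' by (simp add: Infty abs_divide)
      show "rat_map p q (id (Fin w)) = id (Fin (poly p w / poly q w))" if "poly q w \<noteq> 0" for w
        using that by simp
      show "local_mult p q (id (Fin w)) = order w (p - smult (poly p w / poly q w) q)"
        if "poly q w \<noteq> 0" for w using that by simp
      show "\<exists>a r w. 0 < r \<and> is_direction v a r w \<and>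
        (\<forall>e>0. \<exists>e'>0. \<forall>\<eta>. 0 < \<eta> \<and> \<eta> < e' \<longrightarrow>
          (\<exists>\<epsilon>. 0 < \<epsilon> \<and> \<epsilon> \<le> e \<and> dir_annulus v a r w \<eta> = id ` Fin ` annulus b s (s + \<epsilon>)))"
        if "0 < s" for b s
      proof (intro exI conjI allI impI)
        show "is_direction v b s Infty" by (simp add: is_direction_def)
        show "dir_annulus v b s Infty \<eta> = id ` Fin ` annulus b s (s + \<eta>)" for \<eta>
          by (simp add: annulus_def)
        fix e :: real assume "e > 0"
        then show "0 < e" .
      qed (use that in auto)
      show "\<exists>e>s. \<forall>t. s < t \<and> t < e \<longrightarrow> is_open_annulus v (id ` Fin ` annulus b s t)"
        if "0 < s" for b s
        using that is_open_annulus_Fin by (intro exI[of _ "s + 1"]) simp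
      show "is_disk v (id ` insert Infty (Fin ` {x. s < v (x - b)}))" if "0 < s" for b s
        unfolding image_id complement_closed_disk[symmetric] is_disk_def using that by auto
      show "(\<lambda>n. chordal v (id (Fin (w n))) \<gamma>) \<longlonglongrightarrow> 0"
        if "filterlim (\<lambda>n. v (w n)) at_top sequentially" for w
      proof -
        have "filterlim (\<lambda>n. max 1 (v (w n))) at_top sequentially"
          using that by (rule filterlim_at_top_mono) simp
        from tendsto_inverse_0_at_top[OF this] show ?thesis by (simp add: Infty inverse_eq_divide)
      qed
      show "v (multiplier p q \<gamma>) < v (of_nat (dir_degree v p q a r w)) ^ d"
        if "r > 0" "is_direction v a r w" for a r w using dd[OF that] .
    qed
    show ?thesis by (rule critical_value_attracted)
  next
    case (Fin c)
    let ?g = "p - smult c q"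
    have degg: "degree ?g \<le> d" using deg degree_smult_le[of c q] by (intro degree_diff_le) auto
    have qc: "poly q c \<noteq> 0" and pc: "poly p c = c * poly q c"
      using assms(7) Fin by (auto simp: field_simps split: if_splits)
    define P Q where "P = at_inv_coord d c q" and "Q = at_inv_coord d c ?g"
    \<comment> \<open>Because of \<open>pc\<close>, the derivative of \<open>p / q\<close> at
      \<open>c\<close> is that of \<open>p - c * q\<close> divided by the value of
      \<open>q\<close>.\<close>
    have mul: "multiplier p q (Fin c) = poly (pderiv ?g) c / poly q c"
      using qc by (simp add: rat_deriv_def pc pderiv_diff pderiv_smult power2_eq_square field_simps)
    have cP: "coeff P d = poly q c" "degree P \<le> d"
      using coeff_at_inv_coord[OF deg(2)] by (simp_all add: P_def)
    then have dP: "degree P = d" using qc le_degree[of P d] by simp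
    have cQ: "coeff Q d = 0" "coeff Q (d - 1) = poly (pderiv ?g) c" "degree Q \<le> d"
      using coeff_at_inv_coord[OF degg] pc assms(5) by (simp_all add: Q_def)
    \<comment> \<open>As in the other case, the nonzero multiplier determines the degree of the
      denominator.\<close>
    have "coeff Q (d - 1) \<noteq> 0" using mult0 mul Fin cQ by auto
    moreover from this have "Q \<noteq> 0" by auto
    then have "degree Q \<noteq> d" using cQ(1) by (metis leading_coeff_0_iff)
    ultimately have dQ: "degree Q = d - 1" using le_degree[of Q "d - 1"] cQ(3) by simp
    \<comment> \<open>A vanishing fibre polynomial over a finite value would make the map constant,
      against coprimality and \<open>d \<ge> 2\<close>.\<close>
    have fib: "fibre_poly p q y \<noteq> 0" for y
    proof (cases y)
      case (Fin c')
      show ?thesis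
      proof
        assume "fibre_poly p q y = 0"
        then have pq: "p = smult c' q" using Fin by simp
        show False
        proof (cases "degree q = 0")
          case True
          then show False using pq assms(4,5) degree_smult_le[of c' q] by (simp add: rat_degree_def)
        next
          case False
          then obtain x where "poly q x = 0" using alg_closed_imp_poly_has_root by blast
          then show False using common[of x] pq by simp
        qed
      qed
    qed (use assms(3) in simp)
    note tr = local_mult_inv_coord[OF assms(4) pc _ fib]
    interpret normal_form v p q P Q d \<gamma> "inv_coord c"
    proof
      show "degree P = d" "d \<ge> 2" by (fact dP assms(5))+
      show "Suc (degree Q) = d" using dQ assms(5) by simp
      show "poly Q x \<noteq> 0" if "poly P x = 0" for x
      proof
        assume Q0: "poly Q x = 0"
        show False
        proof (cases "x = 0")
          \<comment> \<open>\<open>w = 0\<close> corresponds to \<open>z = \<infinity>\<close>: a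
            common root there would make both coefficients of degree \<open>d\<close> vanish,
            against \<open>rat_degree p q = d\<close>.\<close>
          case True
          then have *: "coeff q d = 0" "coeff p d = 0"
            using that Q0 deg degg by (auto simp: P_def Q_def poly_at_inv_coord)
          have "degree f \<noteq> d" if "f = p \<or> f = q" for f
          proof
            assume "degree f = d"
            then have "f = 0" using * that by (metis leading_coeff_0_iff)
            then show False using \<open>degree f = d\<close> assms(5) by simp
          qed
          then show False using assms(4) by (metis max_def rat_degree_def)
        next
          case False
          then have "poly q (c + 1 / x) = 0" "poly p (c + 1 / x) = 0"
            using that Q0 deg degg by (auto simp: P_def Q_def poly_at_inv_coord)
          then show False using common by blast
        qed
      qed
      show "of_nat m \<noteq> (0 :: 'k)" if "0 < m" "m \<le> d" for m using char that .
      show "rat_map p q \<gamma> = \<gamma>" by (fact assms(7))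
      show "inj (inv_coord c)" using bij_inv_coord by (rule bij_is_inj)
      show "inv_coord c Infty = \<gamma>" by (simp add: Fin)
      show "v (multiplier p q \<gamma>) = v (lead_coeff Q) / v (lead_coeff P)"
        using mul cP(1) cQ(2) dP dQ by (simp add: Fin abs_divide)
      show "rat_map p q (inv_coord c (Fin w)) = inv_coord c (Fin (poly P w / poly Q w))"
        if "poly Q w \<noteq> 0" for w
        using tr(1)[of w] that unfolding P_def Q_def by blast
      show "local_mult p q (inv_coord c (Fin w)) = order w (P - smult (poly P w / poly Q w) Q)"
        if "poly Q w \<noteq> 0" for w
        using tr(2)[of w] that unfolding P_def Q_def by blast
      show "(\<lambda>n. chordal v (inv_coord c (Fin (w n))) \<gamma>) \<longlonglongrightarrow> 0"
        if "filterlim (\<lambda>n. v (w n)) at_top sequentially" for w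
        using inv_coord_chordal[OF that] unfolding Fin .
      show "v (multiplier p q \<gamma>) < v (of_nat (dir_degree v p q a r w)) ^ d"
        if "r > 0" "is_direction v a r w" for a r w using dd[OF that] .
    qed (fact inv_coord_direction inv_coord_open_annulus inv_coord_disk)+
    show ?thesis by (rule critical_value_attracted)
  qed
qed

end
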